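(* The Weil-Petersson two form $\omega$ on $\tilde T(\mathcal H_G)$ projects to a non-degenerate two form on the Teichmüller space $T(\mathcal H_G)$. That is: $\omega_{\lambda^1}(u^1,v^1)=\omega_{\lambda^2}(u^2,v^2)$ whenever $\pi(\lambda^1)=\pi(\lambda^2)$, $d\pi_{\lambda^1}(u^1)=d\pi_{\lambda^2}(u^2)$ and $d\pi_{\lambda^1}(v^1)=d\pi_{\lambda^2}(v^2)$; and for every tangent vector $v$ at a point $\lambda\in\tilde T(\mathcal H_G)$ with $d\pi_\lambda(v)\neq0$ there is a tangent vector $u$ at $\lambda$ with $\omega_\lambda(u,v)\neq0$.
   Context: **Setting.** $\mathbb D$ is the unit disk with its hyperbolic metric. $\tau_*$ is the Farey tesselation (a set of geodesic edges) of $\mathbb D$, obtained from the ideal triangle with vertices $1,-1,-i$ by repeated reflection in its sides; $PSL_2(\mathbb Z)$ is the group of orientation-preserving isometries preserving $\tau_*$. $G<PSL_2(\mathbb Z)$ is the once-punctured torus group (characteristic of index six), which has as fundamental domain the ideal quadrilateral with vertices $1,i,-1,-i$; $\hat G$ is its profinite completion, and $\mathcal H_G=(\mathbb D\times\hat G)/G$ is the punctured solenoid, with $\gamma(z,t)=(\gamma z,t\gamma^{-1})$. **Decorated Teichmüller space and tangent vectors.** $\tilde T(\mathcal H_G)$, the space of decorated hyperbolic structures on $\mathcal H_G$, is identified by lambda lengths with $Cont^G(\hat G,\mathbb R_{>0}^{\tau_*})$: continuous functions $\lambda:\hat G\to\mathbb R_{>0}^{\tau_*}$ (supremum topology on $\mathbb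 R^{\tau_*}$), written $\lambda(t,e)$, with $\lambda(t\gamma^{-1},\gamma e)=\lambda(t,e)$ for all $\gamma\in G$. It is open in the vector space $Cont^G(\hat G,\mathbb R^{\tau_*})$ of $G$-invariant continuous functions with norm $\|v\|=\sup_{t,e}|v(t,e)|$, which is identified with the tangent space at every point. **Projection.** $\pi:\tilde T(\mathcal H_G)\to T(\mathcal H_G)$ forgets the decoration. In coordinates it is given by the cross ratios $\frac{\lambda(t,a)\lambda(t,c)}{\lambda(t,b)\lambda(t,d)}$ over all $t\in\hat G$ and all quadrilaterals with consecutive sides $a,b,c,d$ that are unions of two adjacent triangles of $\tau_*$: $\pi(\lambda^1)=\pi(\lambda^2)$ iff all these cross ratios agree; when $\pi(\lambda^1)=\pi(\lambda^2)$, $d\pi_{\lambda^1}(u^1)=d\pi_{\lambda^2}(u^2)$ iff the derivatives of all these cross ratios agree, equivalently the quantities $\frac{u(t,a)}{\lambda(t,a)}+\frac{u(t,c)}{\lambda(t,c)}-\frac{u(t,b)}{\lambda(t,b)}-\frac{u(t,d)}{\lambda(t,d)}$ agree. **Weil-Petersson form.** Let $T_1$ be the ideal triangle with vertices $-1,-i,1$ and $T_2$ the one with vertices $1,i,-1$; they share the edge $e_0$ joining $\pm1$. In counterclockwise order the edges of $T_1$ are $e_0,e_{1/2},e_{2/1}$ with $e_{1/2}$ joining $-1,-i$ and $e_{2/1}$ joining $-i,1$, and those of $T_2$ are $e_0,e_{-2/1},e_{-1/2}$ with $e_{-2/1}$ joining $1,i$ and $e_{-1/2}$ joining $i,-1$.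 For $\lambda\in\tilde T(\mathcal H_G)$, tangent vectors $u,v$ at $\lambda$, $t\in\hat G$ and $i=1,2$, let $\eta^i_{\lambda,u,v}(t)$ be the value on $(u(t,\cdot),v(t,\cdot))$ at $\lambda(t,\cdot)$ of the two form $$-2(d\log a\wedge d\log b+d\log b\wedge d\log c+d\log c\wedge d\log a),$$ where $(a,b,c)$ are the lambda lengths of the edges of $T_i$ in counterclockwise order. Then $$\omega_\lambda(u,v)=\int_{\hat G}[\eta^1_{\lambda,u,v}(t)+\eta^2_{\lambda,u,v}(t)]\,dm(t),$$ with $m$ the Haar probability measure on $\hat G$. *)

theory Defs
  imports
    "HOL-Complex_Analysis.Complex_Analysis"
    "HOL-Probability.Probability"
    "HOL-Algebra.Bij"
    "HOL-Algebra.Generated_Groups"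
    "HOL-Algebra.Product_Groups"
begin

section \<open>The Farey tesselation\<close>

text \<open>A geodesic of the unit disk is given by the set of its two ideal endpoints on the unit
  circle, an ideal triangle by the set of its three vertices.

  The geodesic with endpoints \<open>p \<noteq> q\<close> lies on the circle orthogonal to the unit circle with centre
  \<open>c = 2pq/(p + q)\<close>, and the reflection in it is the inversion
  \<open>z \<mapsto> c + (\<bar>c\<bar>\<^sup>2 - 1) / cnj (z - c)\<close>. Since \<open>cnj c = 2/(p + q)\<close>, this is the formula below, which
  also covers \<open>q = -p\<close>, where it becomes the Euclidean reflection \<open>z \<mapsto> p\<^sup>2 cnj z\<close>.\<close>

definition geodesic_reflection :: "complex \<Rightarrow> complex \<Rightarrow> complex \<Rightarrow> complex" where
  "geodesic_reflection p q z = (2 * p * q * cnj z - (p + q)) / ((p + q) * cnj z - 2)"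

inductive_set farey_triangles :: "complex set set" where
  initial: "{1, -1, -\<i>} \<in> farey_triangles"
| reflected: "\<lbrakk>T \<in> farey_triangles; p \<in> T; q \<in> T; p \<noteq> q\<rbrakk>
    \<Longrightarrow> geodesic_reflection p q ` T \<in> farey_triangles"

type_synonym edge = "complex set"

definition farey_edges :: "edge set" where
  "farey_edges = {{p, q} | p q. p \<noteq> q \<and> (\<exists>T\<in>farey_triangles. p \<in> T \<and> q \<in> T)}"

text \<open>Consecutive sides of an ideal quadrilateral with consecutive vertices \<open>p, q, r, s\<close> that is
  the union of the two adjacent triangles \<open>pqr\<close> and \<open>prs\<close>.\<close>

definition farey_quadrilaterals :: "(edge \<times> edge \<times> edge \<times> edge) set" where
  "farey_quadrilaterals = {({p, q}, {q, r}, {r, s}, {s, p}) | p q r s.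
     {p, q, r} \<in> farey_triangles \<and> {p, r, s} \<in> farey_triangles \<and> q \<noteq> s}"


section \<open>The modular group and the once-punctured torus group\<close>

text \<open>The orientation-preserving isometries of the disk are the maps \<open>Moebius_function t w\<close> with
  \<open>norm w < 1\<close>. They are taken on the closed disk, so that they act on ideal points and hence, by
  taking images, on edges; equality of functions is made meaningful by restriction.\<close>

definition disk_isometries :: "(complex \<Rightarrow> complex) set" where
  "disk_isometries = {restrict (Moebius_function t w) (cball 0 1) | t w. norm w < 1}"

definition PSL2Z :: "(complex \<Rightarrow> complex) monoid" where
  "PSL2Z = BijGroup (cball 0 1)
     \<lparr>carrier := {f \<in> disk_isometries. (`) f ` farey_edges = farey_edges}\<rparr>"

text \<open>The once-punctured torus group is generated by the two elements of \<open>PSL2Z\<close> that glue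
  opposite sides of the ideal quadrilateral with vertices \<open>1, \<i>, -1, -\<i>\<close> in such a way that the
  quotient is an oriented surface: the side from \<open>-1\<close> to \<open>-\<i>\<close> goes to the side from \<open>\<i>\<close> to \<open>1\<close>,
  and the side from \<open>-\<i>\<close> to \<open>1\<close> to the side from \<open>-1\<close> to \<open>\<i>\<close>. This makes all four vertices
  equivalent, so the quotient is a torus with one puncture. (An element of \<open>PSL2Z\<close> is determined by
  its values at the two endpoints of an edge, so each disjunct describes exactly one map; both maps
  are hyperbolic of trace 3.)\<close>

definition torus_side_pairings :: "(complex \<Rightarrow> complex) set" where
  "torus_side_pairings = {f \<in> carrier PSL2Z.
     (f (-1) = \<i> \<and> f (-\<i>) = 1) \<or> (f (-\<i>) = -1 \<and> f 1 = \<i>)}"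

definition torus_group :: "(complex \<Rightarrow> complex) monoid" where
  "torus_group = PSL2Z\<lparr>carrier := generate PSL2Z torus_side_pairings\<rparr>"


section \<open>Profinite completion and Haar measure\<close>

definition finite_index_normal :: "('a, 'b) monoid_scheme \<Rightarrow> 'a set set" where
  "finite_index_normal G = {N. N \<lhd> G \<and> finite (rcosets\<^bsub>G\<^esub> N)}"

text \<open>The inverse limit of the finite quotients: for \<open>N \<subseteq> M\<close> the projection \<open>G Mod N \<rightarrow> G Mod M\<close>
  sends a coset of \<open>N\<close> to the coset of \<open>M\<close> containing it.\<close>

definition profinite_completion :: "('a, 'b) monoid_scheme \<Rightarrow> ('a set \<Rightarrow> 'a set) monoid" where
  "profinite_completion G = (product_group (finite_index_normal G) (\<lambda>N. G Mod N))
     \<lparr>carrier := {x \<in> \<Pi>\<^sub>E N\<in>finite_index_normal G. carrier (G Mod N).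
        \<forall>N\<in>finite_index_normal G. \<forall>M\<in>finite_index_normal G. N \<subseteq> M \<longrightarrow> x N \<subseteq> x M}\<rparr>"

definition profinite_topology :: "('a, 'b) monoid_scheme \<Rightarrow> ('a set \<Rightarrow> 'a set) topology" where
  "profinite_topology G = subtopology
     (product_topology (\<lambda>N. discrete_topology (carrier (G Mod N))) (finite_index_normal G))
     (carrier (profinite_completion G))"

definition profinite_embedding :: "('a, 'b) monoid_scheme \<Rightarrow> 'a \<Rightarrow> ('a set \<Rightarrow> 'a set)" where
  "profinite_embedding G g = (\<lambda>N\<in>finite_index_normal G. N #>\<^bsub>G\<^esub> g)"

text \<open>For a compact group, as here, Haar measure is both left and right invariant, and it is the
  only measure with the following property.\<close>

definition haar_probability ::
    "('a, 'b) monoid_scheme \<Rightarrow> 'a topology \<Rightarrow> 'a measure \<Rightarrow> bool" where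
  "haar_probability K T m \<longleftrightarrow>
     prob_space m \<and>
     sets m = sets (sigma (topspace T) {U. openin T U}) \<and>
     (\<forall>g\<in>carrier K. \<forall>A\<in>sets m.
        emeasure m ((\<lambda>x. g \<otimes>\<^bsub>K\<^esub> x) ` A) = emeasure m A \<and>
        emeasure m ((\<lambda>x. x \<otimes>\<^bsub>K\<^esub> g) ` A) = emeasure m A)"

abbreviation Ghat :: "((complex \<Rightarrow> complex) set \<Rightarrow> (complex \<Rightarrow> complex) set) monoid" where
  "Ghat \<equiv> profinite_completion torus_group"

abbreviation Ghat_topology ::
    "((complex \<Rightarrow> complex) set \<Rightarrow> (complex \<Rightarrow> complex) set) topology" where
  "Ghat_topology \<equiv> profinite_topology torus_group"


section \<open>Decorated Teichmueller space\<close>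

type_synonym ghat = "(complex \<Rightarrow> complex) set \<Rightarrow> (complex \<Rightarrow> complex) set"
type_synonym edge_family = "ghat \<Rightarrow> edge \<Rightarrow> real"

text \<open>Continuity into the space of functions on the edges with the supremum topology is uniform
  convergence over all edges. Only the values at \<open>t \<in> carrier Ghat\<close> and \<open>e \<in> farey_edges\<close> are
  meaningful, here and below.\<close>

definition invariant_continuous :: "edge_family set" where
  "invariant_continuous = {v.
     (\<forall>t\<in>carrier Ghat. uniform_limit farey_edges v (v t) (atin Ghat_topology t)) \<and>
     (\<forall>g\<in>carrier torus_group. \<forall>t\<in>carrier Ghat. \<forall>e\<in>farey_edges.
        v (t \<otimes>\<^bsub>Ghat\<^esub> profinite_embedding torus_group (inv\<^bsub>torus_group\<^esub> g)) (g ` e) = v t e)}"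

text \<open>Points are given by their lambda lengths; the tangent space at every point is
  \<open>invariant_continuous\<close>.\<close>

definition decorated_teichmueller :: "edge_family set" where
  "decorated_teichmueller =
     {l \<in> invariant_continuous. \<forall>t\<in>carrier Ghat. \<forall>e\<in>farey_edges. l t e > 0}"

type_synonym quad_family = "ghat \<times> edge \<times> edge \<times> edge \<times> edge \<Rightarrow> real"

text \<open>The projection to Teichmueller space in cross ratio coordinates. Outside of the index set
  the family is 0, so that equality of families is equality of all coordinates.\<close>

definition teichmueller_proj :: "edge_family \<Rightarrow> quad_family" where
  "teichmueller_proj l = (\<lambda>(t, a, b, c, d).
     if t \<in> carrier Ghat \<and> (a, b, c, d) \<in> farey_quadrilaterals
     then (l t a * l t c) / (l t b * l t d) else 0)"

definition d_teichmueller_proj :: "edge_family \<Rightarrow> edge_family \<Rightarrow> quad_family" where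
  "d_teichmueller_proj l u =
     (\<lambda>x. deriv (\<lambda>s. teichmueller_proj (\<lambda>t e. l t e + s * u t e) x) 0)"


section \<open>The Weil-Petersson form\<close>

text \<open>The form \<open>d log a \<and> d log b\<close> for the lambda lengths of the edges \<open>a\<close> and \<open>b\<close>, at the point
  \<open>l\<close> and on the tangent vectors \<open>u\<close> and \<open>v\<close>, all at a fixed element of the profinite group.\<close>

definition dlog_wedge ::
    "(edge \<Rightarrow> real) \<Rightarrow> (edge \<Rightarrow> real) \<Rightarrow> (edge \<Rightarrow> real) \<Rightarrow> edge \<Rightarrow> edge \<Rightarrow> real" where
  "dlog_wedge l u v a b = (u a / l a) * (v b / l b) - (v a / l a) * (u b / l b)"

definition wp_triangle ::
    "(edge \<Rightarrow> real) \<Rightarrow> (edge \<Rightarrow> real) \<Rightarrow> (edge \<Rightarrow> real) \<Rightarrow> edge \<Rightarrow> edge \<Rightarrow> edge \<Rightarrow> real" where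
  "wp_triangle l u v a b c =
     -2 * (dlog_wedge l u v a b + dlog_wedge l u v b c + dlog_wedge l u v c a)"

definition weil_petersson ::
    "ghat measure \<Rightarrow> edge_family \<Rightarrow> edge_family \<Rightarrow> edge_family \<Rightarrow> real" where
  "weil_petersson m l u v = (LINT t|m.
     wp_triangle (l t) (u t) (v t) {1, -1} {-1, -\<i>} {-\<i>, 1} +
     wp_triangle (l t) (u t) (v t) {1, -1} {1, \<i>} {\<i>, -1})"

end

theory Submission
  imports Defs
begin

text \<open>Write \<open>x = u/\<lambda>\<close> and \<open>y = v/\<lambda>\<close> for the logarithmic derivatives, and \<open>S x\<close> for the shear of
  \<open>x\<close>, the alternating sum of \<open>x\<close> over the sides of the counterclockwise quadrilateral around an edge.
  Moving the contributions of paired sides of the fundamental quadrilateral onto each other by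
  invariance of Haar measure turns the form into
  \<open>\<omega>(u, v) = 2 \<integral> (\<Sum>e. S x e * y e) dm\<close>, the sum being over three representatives of the edge orbits
  of \<open>G\<close>. The shears determine, and are determined by, the derivatives of the cross ratios. Hence
  \<open>\<omega>(u, v)\<close> depends on \<open>u\<close> only through its projection, and by antisymmetry the same holds for \<open>v\<close>.
  If \<open>S y \<noteq> 0\<close> then pairing \<open>v\<close> with \<open>u = S y\<close> gives \<open>- 2 \<integral> (\<Sum>e. (S y e)\<^sup>2 / \<lambda> e) dm < 0\<close>, because
  Haar measure charges open sets.

  The combinatorics of the Farey tesselation is done in lattice coordinates: an ideal point is
  \<open>v / cnj v\<close> for a Gaussian integer \<open>v\<close>, an edge is a pair of vectors spanning the lattice, and a
  disk isometry acts by a real-linear map \<open>v \<mapsto> a v + b cnj v\<close>.\<close>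


section \<open>Ideal points of lattice vectors\<close>

text \<open>Two obstacles shape the proof. First, \<open>PSL2Z\<close> is defined by its action on
  the set of edges, while invariance of the shear needs more: the two triangles at an edge must go
  to the two triangles at the image edge with their cyclic order kept. Lattice coordinates make this
  a determinant argument (\<open>PSL2Z_unimodular\<close>). In them the triangles at the edge of
  \<open>v\<close>, \<open>w\<close> have third vertices \<open>v + w\<close> and
  \<open>v - w\<close>, reflection in the edge changes the sign of one coordinate, and an edge
  determines its basis up to a common sign and the quarter turn from \<open>(v, w)\<close> to
  \<open>(w, - v)\<close>. Second, tangent vectors are continuous in the supremum over infinitely
  many edges, so dividing by lambda lengths could leave the space. Invariance helps: a translate of
  an edge can be exchanged for a shift of the profinite variable, so that bounds, and at the end the
  vanishing of all shears, are settled at three edges over a compact group. The shear is itself an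
  invariant continuous function of edges; this is what makes it available as a tangent vector
  \<open>u\<close> and avoids any construction of a dual vector.\<close>

definition wedge :: "complex \<Rightarrow> complex \<Rightarrow> real" where
  "wedge v w = Im (cnj v * w)"

text \<open>Doubles the argument of \<open>v\<close>: real lines through the origin become points of
  the circle. The sign and the length of \<open>v\<close> are lost, which is the source of all sign
  ambiguities below.\<close>

definition ideal_point :: "complex \<Rightarrow> complex" where
  "ideal_point v = v / cnj v"

definition gaussian :: "complex \<Rightarrow> bool" where
  "gaussian v \<longleftrightarrow> Re v \<in> \<int> \<and> Im v \<in> \<int>"

text \<open>A positively oriented basis of the Gaussian integers. Asking for determinant
  \<open>1\<close>, not merely up to sign, is what later fixes the sign of the shear.\<close>

definition unimodular :: "complex \<Rightarrow> complex \<Rightarrow> bool" where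
  "unimodular v w \<longleftrightarrow> gaussian v \<and> gaussian w \<and> wedge v w = 1"

lemma wedge_eq: "wedge v w = Re v * Im w - Im v * Re w"
  by (simp add: wedge_def)

lemma wedge_skew: "wedge w v = - wedge v w"
  by (simp add: wedge_eq)

lemma wedge_nonzeroD:
  assumes "wedge v w \<noteq> 0"
  shows "v \<noteq> 0" "w \<noteq> 0"
  using assms by (auto simp: wedge_eq)

lemma wedge_in_Ints: "gaussian v \<Longrightarrow> gaussian w \<Longrightarrow> wedge v w \<in> \<int>"
  by (simp add: gaussian_def wedge_eq)

lemma norm_ideal_point: "v \<noteq> 0 \<Longrightarrow> norm (ideal_point v) = 1"
  by (simp add: ideal_point_def norm_divide)

lemma ideal_point_minus [simp]: "ideal_point (- v) = ideal_point v"
  by (simp add: ideal_point_def)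

lemma ideal_point_diff_commute: "ideal_point (v - w) = ideal_point (w - v)"
  using ideal_point_minus[of "w - v"] by simp

lemma ideal_point_scaleR: "c \<noteq> 0 \<Longrightarrow> ideal_point (of_real c * v) = ideal_point v"
  by (simp add: ideal_point_def)

lemma ideal_point_eq_iff:
  assumes "v \<noteq> 0" "w \<noteq> 0"
  shows "ideal_point v = ideal_point w \<longleftrightarrow> wedge v w = 0"
proof -
  have "ideal_point v = ideal_point w \<longleftrightarrow> v * cnj w = w * cnj v"
    using assms by (simp add: ideal_point_def frac_eq_eq)
  also have "\<dots> \<longleftrightarrow> wedge v w = 0"
    by (auto simp: complex_eq_iff wedge_eq algebra_simps)
  finally show ?thesis .
qed

text \<open>Cramer's rule.\<close>

lemma wedge_expansion:
  assumes "wedge v w \<noteq> 0"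
  shows "u = of_real (wedge u w / wedge v w) * v + of_real (wedge v u / wedge v w) * w"
proof -
  have "of_real (wedge v w) * u = of_real (wedge u w) * v + of_real (wedge v u) * w"
    by (simp add: complex_eq_iff wedge_eq algebra_simps)
  with assms show ?thesis
    by (simp add: field_simps)
qed

lemma proportional_if_wedge_eq_0:
  assumes "v \<noteq> 0" "wedge v u = 0"
  obtains c where "u = of_real c * v"
proof -
  \<comment> \<open>A quarter turn completes \<open>v\<close> to a basis, since
    \<open>wedge v w\<close> is then the squared norm.\<close>
  define w where "w = \<i> * v"
  have "wedge v w = (Re v)\<^sup>2 + (Im v)\<^sup>2"
    by (simp add: wedge_eq w_def power2_eq_square)
  then have "wedge v w \<noteq> 0"
    using assms(1) by (simp add: complex_eq_iff sum_power2_eq_zero_iff)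
  from wedge_expansion[OF this, of u] assms(2) show ?thesis
    by (intro that[of "wedge u w / wedge v w"]) simp
qed

lemma same_ideal_point:
  assumes "v \<noteq> 0" "u \<noteq> 0" "ideal_point u = ideal_point v"
  obtains c where "c \<noteq> 0" "u = of_real c * v"
proof -
  have "wedge v u = 0"
    using assms ideal_point_eq_iff by metis
  then obtain c where "u = of_real c * v"
    using proportional_if_wedge_eq_0 assms by blast
  with assms that show ?thesis by force
qed

lemma unimodularD:
  assumes "unimodular v w"
  shows "v \<noteq> 0" "w \<noteq> 0" "ideal_point v \<noteq> ideal_point w" "wedge v w = 1"
    "gaussian v" "gaussian w"
proof -
  show *: "wedge v w = 1" "gaussian v" "gaussian w"
    using assms by (auto simp: unimodular_def)
  show "v \<noteq> 0" "w \<noteq> 0"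
    using * wedge_nonzeroD[of v w] by auto
  then show "ideal_point v \<noteq> ideal_point w"
    using * by (simp add: ideal_point_eq_iff)
qed

lemma unimodular_transform:
  assumes "unimodular v w"
  shows "unimodular w (- v)" "unimodular (- v) (- w)" "unimodular v (v + w)" "unimodular (v + w) w"
    "unimodular (v - w) w" "unimodular v (w - v)"
  using assms by (auto simp: unimodular_def gaussian_def wedge_eq algebra_simps)

lemma real_unit_Ints:
  fixes c d :: real
  assumes "c \<in> \<int>" "d \<in> \<int>" "c * d = 1"
  shows "(c = 1 \<and> d = 1) \<or> (c = -1 \<and> d = -1)"
proof -
  obtain i j :: int where ij: "c = of_int i" "d = of_int j"
    using assms by (auto elim!: Ints_cases)
  with assms(3) have "of_int (i * j) = (1::real)" by simp
  then have "i * j = 1" using of_int_eq_1_iff by blast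
  with ij show ?thesis by (auto simp: zmult_eq_1_iff)
qed

text \<open>The scaling factors are \<open>wedge v' w\<close> and \<open>wedge v w'\<close>, hence
  integers, and their product is a quotient of determinants, \<open>1\<close>; so both are
  \<open>1\<close> or both are \<open>-1\<close>. Consequently the points of \<open>v + w\<close>
  and \<open>v - w\<close> depend only on the two endpoints in their order.\<close>

lemma unimodular_same_ideal_points:
  assumes vw: "unimodular v w" and vw': "unimodular v' w'"
    and eq: "ideal_point v' = ideal_point v" "ideal_point w' = ideal_point w"
  shows "(v' = v \<and> w' = w) \<or> (v' = - v \<and> w' = - w)"
proof -
  obtain c where c: "v' = of_real c * v"
    using same_ideal_point[of v v'] eq unimodularD[OF vw] unimodularD[OF vw'] by metis
  obtain d where d: "w' = of_real d * w"
    using same_ideal_point[of w w'] eq unimodularD[OF vw] unimodularD[OF vw'] by metis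
  have 1: "wedge v w = 1" "wedge v' w' = 1"
    using vw vw' by (auto simp: unimodular_def)
  have "wedge v' w = c * wedge v w" "wedge v w' = d * wedge v w" "wedge v' w' = c * d * wedge v w"
    by (auto simp: c d wedge_eq algebra_simps)
  with 1 have *: "c = wedge v' w" "d = wedge v w'" "c * d = 1" by auto
  then have "c \<in> \<int>" "d \<in> \<int>"
    using vw vw' by (auto simp: unimodular_def intro: wedge_in_Ints)
  from real_unit_Ints[OF this *(3)] show ?thesis by (auto simp: c d)
qed

text \<open>In the basis \<open>v\<close>, \<open>w\<close> the reflection acts on lines as the
  diagonal matrix with entries \<open>1\<close> and \<open>-1\<close>.\<close>

lemma geodesic_reflection_ideal_point:
  assumes "wedge v w \<noteq> 0" "a \<noteq> 0 \<or> b \<noteq> 0"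
  shows "geodesic_reflection (ideal_point v) (ideal_point w)
           (ideal_point (of_real a * v + of_real b * w)) = ideal_point (of_real a * v - of_real b * w)"
proof -
  let ?n = "of_real a * v + of_real b * w"
  have "a * wedge v w = wedge ?n w" "b * wedge v w = wedge v ?n"
    by (simp_all add: wedge_eq algebra_simps)
  moreover have "wedge 0 w = 0" "wedge v 0 = 0" by (simp_all add: wedge_def)
  ultimately have n: "?n \<noteq> 0" using assms by force
  have v: "v \<noteq> 0" and w: "w \<noteq> 0" using wedge_nonzeroD[OF assms(1)] by auto
  \<comment> \<open>\<open>k\<close> equals \<open>2 * \<i> * wedge v w\<close>. Once numerator and
    denominator of the reflection are multiplied by \<open>D\<close>, it is their common factor and
    cancels.\<close>
  define k where "k = w * cnj v - v * cnj w"
  have "Im k = 2 * wedge v w" by (simp add: k_def wedge_eq)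
  then have k: "k \<noteq> 0" using assms(1) by auto
  define D where "D = cnj v * cnj w * ?n"
  have D: "D \<noteq> 0" using v w n by (simp add: D_def)
  define p q z where "p = ideal_point v" "q = ideal_point w" "z = ideal_point ?n"
  have p: "p * cnj v = v" and q: "q * cnj w = w" and z: "cnj z * ?n = cnj ?n"
    using v w n by (simp_all add: p_q_z_def ideal_point_def del: complex_cnj_add)
  have "(2 * p * q * cnj z - (p + q)) * D
      = 2 * (p * cnj v) * (q * cnj w) * (cnj z * ?n) - ((p * cnj v) * cnj w + (q * cnj w) * cnj v) * ?n"
    by (simp add: D_def algebra_simps)
  also have "\<dots> = k * (of_real a * v - of_real b * w)"
    unfolding p q z by (simp add: k_def algebra_simps)
  finally have X: "2 * p * q * cnj z - (p + q) = k * (of_real a * v - of_real b * w) / D"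
    using D by (simp add: field_simps)
  have "((p + q) * cnj z - 2) * D
      = ((p * cnj v) * cnj w + (q * cnj w) * cnj v) * (cnj z * ?n) - 2 * cnj v * cnj w * ?n"
    by (simp add: D_def algebra_simps)
  also have "\<dots> = k * cnj (of_real a * v - of_real b * w)"
    unfolding p q z by (simp add: k_def algebra_simps)
  finally have Y: "(p + q) * cnj z - 2 = k * cnj (of_real a * v - of_real b * w) / D"
    using D by (simp add: field_simps)
  show ?thesis
    unfolding geodesic_reflection_def p_q_z_def[symmetric] X Y using k D
    by (simp add: ideal_point_def)
qed

lemma geodesic_reflection_unimodular:
  assumes "unimodular v w"
  shows "geodesic_reflection (ideal_point v) (ideal_point w) (ideal_point v) = ideal_point v"
    "geodesic_reflection (ideal_point v) (ideal_point w) (ideal_point w) = ideal_point w"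
    "geodesic_reflection (ideal_point v) (ideal_point w) (ideal_point (v + w)) = ideal_point (v - w)"
    "geodesic_reflection (ideal_point v) (ideal_point w) (ideal_point (v - w)) = ideal_point (v + w)"
  using geodesic_reflection_ideal_point[of v w 1 0] geodesic_reflection_ideal_point[of v w 0 1]
    geodesic_reflection_ideal_point[of v w 1 1] geodesic_reflection_ideal_point[of v w 1 "-1"]
    unimodularD(4)[OF assms] by auto


section \<open>The Farey tesselation in coordinates\<close>

abbreviation triangle_sum :: "complex \<Rightarrow> complex \<Rightarrow> complex set" where
  "triangle_sum v w \<equiv> {ideal_point v, ideal_point w, ideal_point (v + w)}"

abbreviation triangle_diff :: "complex \<Rightarrow> complex \<Rightarrow> complex set" where
  "triangle_diff v w \<equiv> {ideal_point v, ideal_point w, ideal_point (v - w)}"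

text \<open>The order of \<open>p\<close> and \<open>q\<close> is prescribed and the basis must be
  positively oriented, so the third vertex is the sum for some ordered sides and the difference for
  the others.\<close>

lemma triangle_side_coordinates:
  assumes "unimodular v w" "T = triangle_sum v w" "p \<in> T" "q \<in> T" "p \<noteq> q"
  obtains v' w' where "unimodular v' w'" "p = ideal_point v'" "q = ideal_point w'"
    "T = triangle_sum v' w' \<or> T = triangle_diff v' w'"
proof -
  note u = unimodular_transform[OF assms(1)]
  consider "p = ideal_point v \<and> q = ideal_point w" | "p = ideal_point w \<and> q = ideal_point v"
    | "p = ideal_point v \<and> q = ideal_point (v + w)" | "p = ideal_point (v + w) \<and> q = ideal_point v"
    | "p = ideal_point w \<and> q = ideal_point (v + w)" | "p = ideal_point (v + w) \<and> q = ideal_point w"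
    using assms by blast
  then show thesis
  proof cases
    case 1
    with assms that show ?thesis by blast
  next
    case 2
    have "triangle_diff w (- v) = T" using assms by (auto simp: add.commute)
    with 2 that[of w "- v"] u show ?thesis by simp
  next
    case 3
    have "triangle_diff v (v + w) = T" using assms by auto
    with 3 that[of v "v + w"] u show ?thesis by simp
  next
    case 4
    have "unimodular (v + w) (- v)"
      using assms(1) by (auto simp: unimodular_def gaussian_def wedge_eq algebra_simps)
    moreover have "triangle_sum (v + w) (- v) = T" using assms by auto
    ultimately show ?thesis
      using 4 that[of "v + w" "- v"] by simp
  next
    case 5
    have "unimodular w (- (v + w))"
      using assms(1) by (auto simp: unimodular_def gaussian_def wedge_eq algebra_simps)
    moreover have "w + - (v + w) = - v" by simp
    then have "triangle_sum w (- (v + w)) = T"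
      using assms by (simp only: ideal_point_minus) auto
    ultimately show ?thesis
      using 5 that[of w "- (v + w)"] ideal_point_minus[of "v + w"] by metis
  next
    case 6
    have "triangle_diff (v + w) w = T" using assms by auto
    with 6 that[of "v + w" w] u show ?thesis by simp
  qed
qed

lemma reflected_triangle_sum:
  assumes "unimodular v w"
  shows "geodesic_reflection (ideal_point v) (ideal_point w) ` triangle_sum v w = triangle_diff v w"
    "geodesic_reflection (ideal_point v) (ideal_point w) ` triangle_diff v w = triangle_sum v w"
  using geodesic_reflection_unimodular[OF assms] by auto

lemma ideal_point_simps [simp]:
  "ideal_point 1 = 1" "ideal_point \<i> = -1" "ideal_point (1 + \<i>) = \<i>" "ideal_point (1 - \<i>) = -\<i>"
  by (simp_all add: ideal_point_def complex_eq_iff Re_divide Im_divide)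

text \<open>Reflection in a side trades sum and difference, and a difference triangle is again a sum
  triangle, because \<open>v\<close> is the sum of \<open>v - w\<close> and
  \<open>w\<close>.\<close>

lemma farey_triangle_coordinates:
  assumes "T \<in> farey_triangles"
  obtains v w where "unimodular v w" "T = triangle_sum v w"
proof -
  have "\<exists>v w. unimodular v w \<and> T = triangle_sum v w"
    using assms
  proof induction
    case initial
    \<comment> \<open>The vectors \<open>-\<i>\<close> and \<open>1\<close> have the ideal points
      \<open>-1\<close> and \<open>1\<close>; their sum \<open>1 - \<i>\<close> has
      \<open>-\<i>\<close>.\<close>
    have "unimodular (-\<i>) 1" "{1, -1, -\<i>} = triangle_sum (-\<i>) 1"
      by (auto simp: unimodular_def gaussian_def wedge_eq)
    then show ?case by blast
  next
    case (reflected T p q)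
    then obtain v w where vw: "unimodular v w" "p = ideal_point v" "q = ideal_point w"
      "T = triangle_sum v w \<or> T = triangle_diff v w"
      using triangle_side_coordinates by metis
    then have "geodesic_reflection p q ` T = triangle_sum v w
        \<or> geodesic_reflection p q ` T = triangle_diff v w"
      using reflected_triangle_sum[OF vw(1)] by auto
    moreover have "triangle_diff v w = triangle_sum (v - w) w" by auto
    ultimately show ?case
      using vw(1) unimodular_transform(5) by metis
  qed
  with that show thesis by blast
qed

lemma farey_triangle_side:
  assumes "T \<in> farey_triangles" "p \<in> T" "q \<in> T" "p \<noteq> q"
  obtains v w where "unimodular v w" "p = ideal_point v" "q = ideal_point w"
    "T = triangle_sum v w \<or> T = triangle_diff v w"
proof -
  obtain v w where "unimodular v w" "T = triangle_sum v w"
    using assms(1) by (rule farey_triangle_coordinates)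
  then show thesis
    using assms(2-4) that by (rule triangle_side_coordinates)
qed

lemma farey_edgeI: "T \<in> farey_triangles \<Longrightarrow> p \<in> T \<Longrightarrow> q \<in> T \<Longrightarrow> p \<noteq> q \<Longrightarrow> {p, q} \<in> farey_edges"
  unfolding farey_edges_def by blast

lemma farey_edge_coordinates:
  assumes "e \<in> farey_edges"
  obtains v w where "unimodular v w" "e = {ideal_point v, ideal_point w}"
proof -
  obtain p q T where e: "e = {p, q}" and pq: "p \<noteq> q" "T \<in> farey_triangles" "p \<in> T" "q \<in> T"
    using assms unfolding farey_edges_def by blast
  show thesis
    by (rule farey_triangle_side[OF pq(2-4,1)]) (rule that, simp_all add: e)
qed

text \<open>By uniqueness of the basis up to sign, a triangle with this side is one of the two;
  reflection in the side then supplies the other.\<close>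

lemma farey_edge_iff:
  assumes "unimodular v w"
  shows "{ideal_point v, ideal_point w} \<in> farey_edges \<longleftrightarrow>
    triangle_sum v w \<in> farey_triangles \<and> triangle_diff v w \<in> farey_triangles"
proof
  assume "{ideal_point v, ideal_point w} \<in> farey_edges"
  then obtain T where T: "T \<in> farey_triangles" "ideal_point v \<in> T" "ideal_point w \<in> T"
    unfolding farey_edges_def by (auto simp: doubleton_eq_iff)
  have ne: "ideal_point v \<noteq> ideal_point w"
    using unimodularD[OF assms] by simp
  obtain v' w' where vw': "unimodular v' w'" "ideal_point v = ideal_point v'"
    "ideal_point w = ideal_point w'" "T = triangle_sum v' w' \<or> T = triangle_diff v' w'"
    using farey_triangle_side[OF T ne] by metis
  have "v' = v \<and> w' = w \<or> v' = - v \<and> w' = - w"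
    using vw' by (intro unimodular_same_ideal_points[OF assms vw'(1)]) simp_all
  moreover have "ideal_point (- v + - w) = ideal_point (v + w)"
    "ideal_point (- v - - w) = ideal_point (v - w)"
    using ideal_point_minus[of "v + w"] ideal_point_minus[of "v - w"] by simp_all
  ultimately have T': "T = triangle_sum v w \<or> T = triangle_diff v w"
    using vw'(4) by (elim disjE conjE) (simp_all only: ideal_point_minus simp_thms)
  have "geodesic_reflection (ideal_point v) (ideal_point w) ` T \<in> farey_triangles"
    using T ne by (rule farey_triangles.reflected)
  with T' T(1) show "triangle_sum v w \<in> farey_triangles \<and> triangle_diff v w \<in> farey_triangles"
    using reflected_triangle_sum[OF assms] by metis
next
  assume "triangle_sum v w \<in> farey_triangles \<and> triangle_diff v w \<in> farey_triangles"
  with unimodularD(3)[OF assms] show "{ideal_point v, ideal_point w} \<in> farey_edges"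
    by (intro farey_edgeI[of "triangle_sum v w"]) simp_all
qed

text \<open>Members of a lattice basis are primitive: the factor between \<open>v\<close> and
  \<open>v'\<close> and its inverse are both determinants of lattice vectors.\<close>

lemma same_ideal_point_unimodular:
  assumes "unimodular v w" "unimodular v' w'" "ideal_point v' = ideal_point v"
  shows "v' = v \<or> v' = - v"
proof -
  obtain c where c: "v' = of_real c * v"
    using same_ideal_point[of v v'] assms unimodularD(1) by metis
  have "wedge v' w = c" "1 = c * wedge v w'"
    using assms(1,2) unfolding c by (auto simp: unimodular_def wedge_eq algebra_simps)
  moreover have "wedge v' w \<in> \<int>" "wedge v w' \<in> \<int>"
    using assms(1,2) by (auto simp: unimodular_def intro: wedge_in_Ints)
  ultimately show ?thesis
    using real_unit_Ints[of c "wedge v w'"] c by auto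
qed

text \<open>Keeps the given \<open>v\<close> itself as first basis vector; sign and order of the
  endpoints are absorbed into \<open>u\<close>.\<close>

lemma farey_neighbour:
  assumes "unimodular v w" "{ideal_point v, y} \<in> farey_edges"
  obtains u where "unimodular v u" "y = ideal_point u"
proof -
  obtain v2 w2 where 2: "unimodular v2 w2" "{ideal_point v, y} = {ideal_point v2, ideal_point w2}"
    using assms(2) by (rule farey_edge_coordinates)
  have *: thesis if "unimodular v2 w2" "ideal_point v = ideal_point v2" "y = ideal_point w2" for v2 w2
  proof -
    from same_ideal_point_unimodular[OF assms(1) that(1)] that(2) have "v2 = v \<or> v2 = - v" by simp
    then have "unimodular v w2 \<or> unimodular v (- w2)"
      using that(1) unimodular_transform(2)[OF that(1)] by auto
    with \<open>\<And>u. unimodular v u \<Longrightarrow> y = ideal_point u \<Longrightarrow> thesis\<close> that show thesis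
      using ideal_point_minus by metis
  qed
  show thesis
    using 2(2) *[OF 2(1)] *[OF unimodular_transform(1)[OF 2(1)]]
    by (auto simp: doubleton_eq_iff)
qed

lemma farey_triangle_points:
  assumes "T \<in> farey_triangles" "z \<in> T"
  obtains v where "v \<noteq> 0" "z = ideal_point v"
proof -
  obtain v w where vw: "unimodular v w" "T = triangle_sum v w"
    using assms(1) by (rule farey_triangle_coordinates)
  note u = unimodularD[OF vw(1)] unimodularD[OF unimodular_transform(4)[OF vw(1)]]
  from vw(2) assms(2) consider "z = ideal_point v" | "z = ideal_point w" | "z = ideal_point (v + w)"
    by blast
  then show thesis
    by cases (use that u in blast)+
qed

lemma farey_triangle_subset: "T \<in> farey_triangles \<Longrightarrow> T \<subseteq> cball 0 1"
  by (auto elim!: farey_triangle_points simp: norm_ideal_point)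

lemma farey_edge_subset: "e \<in> farey_edges \<Longrightarrow> e \<subseteq> cball 0 1"
  using farey_triangle_subset unfolding farey_edges_def by blast


section \<open>Isometries of the disk\<close>

text \<open>A matrix of SU(1,1) up to a real factor, used with \<open>norm b < norm a\<close>. The
  restriction to the closed disk matches \<open>disk_isometries\<close>, so that equality of maps
  makes sense.\<close>

definition disk_moebius :: "complex \<Rightarrow> complex \<Rightarrow> complex \<Rightarrow> complex" where
  "disk_moebius a b = (\<lambda>z\<in>cball 0 1. (a * z + b) / (cnj b * z + cnj a))"

lemma moebius_denominator:
  assumes "norm b < norm a" "norm z \<le> 1"
  shows "cnj b * z + cnj a \<noteq> 0"
proof
  assume "cnj b * z + cnj a = 0"
  then have "norm (cnj a) = norm (cnj b * z)"
    by (metis add_eq_0_iff norm_minus_cancel)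
  also have "\<dots> \<le> norm b"
    using assms(2) mult_left_le[of "norm z" "norm b"] by (simp add: norm_mult)
  finally show False using assms(1) by simp
qed

lemma disk_isometries_eq: "disk_isometries = {disk_moebius a b | a b. norm b < norm a}"
proof (intro equalityI subsetI)
  fix f assume "f \<in> disk_isometries"
  then obtain t w where f: "f = restrict (Moebius_function t w) (cball 0 1)" "norm w < 1"
    unfolding disk_isometries_def by blast
  \<comment> \<open>Half the angle, because \<open>a / cnj a\<close> has to be the rotation factor
    \<open>exp (\<i> * of_real t)\<close>.\<close>
  define a where "a = cis (t / 2)"
  have a: "a * cnj a = 1" "a * a = exp (\<i> * of_real t)"
    by (simp_all add: a_def cis_cnj cis_mult flip: cis_conv_exp)
  have "norm a = 1" by (simp add: a_def)
  have "f = disk_moebius a (- w * a)"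
  proof -
    have "Moebius_function t w z = (a * z + - w * a) / (cnj (- w * a) * z + cnj a)" for z
    proof -
      have "(a * z + - w * a) / (cnj (- w * a) * z + cnj a)
          = (a * (z - w)) / (cnj a * (1 - cnj w * z))"
        by (simp add: algebra_simps)
      also have "\<dots> = (a * (a * (z - w))) / (a * (cnj a * (1 - cnj w * z)))"
        using \<open>norm a = 1\<close> by auto
      also have "\<dots> = Moebius_function t w z"
        by (simp only: mult.assoc[symmetric] a Moebius_function_def mult_1)
      finally show ?thesis ..
    qed
    then show ?thesis by (auto simp: f disk_moebius_def)
  qed
  moreover have "norm (- w * a) < norm a"
    using f(2) by (simp add: norm_mult \<open>norm a = 1\<close>)
  ultimately show "f \<in> {disk_moebius a b | a b. norm b < norm a}" by blast
next
  fix f assume "f \<in> {disk_moebius a b | a b. norm b < norm a}"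
  then obtain a b where f: "f = disk_moebius a b" "norm b < norm a" by blast
  have a: "a \<noteq> 0" using f(2) by auto
  define t where "t = Arg (a / cnj a)"
  have t: "exp (\<i> * of_real t) = a / cnj a"
    using rcis_cmod_Arg[of "a / cnj a"] a
    by (simp add: t_def rcis_def cis_conv_exp norm_divide)
  have "Moebius_function t (- b / a) z = (a * z + b) / (cnj b * z + cnj a)" for z
  proof -
    have "Moebius_function t (- b / a) z = (a * (z + b / a)) / (cnj a * (1 + cnj b / cnj a * z))"
      by (simp add: Moebius_function_def t)
    also have "a * (z + b / a) = a * z + b" using a by (simp add: field_simps)
    also have "cnj a * (1 + cnj b / cnj a * z) = cnj b * z + cnj a" using a by (simp add: field_simps)
    finally show ?thesis .
  qed
  then have "f = restrict (Moebius_function t (- b / a)) (cball 0 1)"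
    by (auto simp: f disk_moebius_def)
  moreover have "norm (- b / a) < 1" using f(2) a by (simp add: norm_divide)
  ultimately show "f \<in> disk_isometries"
    unfolding disk_isometries_def by blast
qed

lemma norm_moebius_le_1:
  assumes "norm b < norm a" "norm z \<le> 1"
  shows "norm (disk_moebius a b z) \<le> 1"
proof -
  have "(norm (cnj b * z + cnj a))\<^sup>2 - (norm (a * z + b))\<^sup>2
      = ((norm a)\<^sup>2 - (norm b)\<^sup>2) * (1 - (norm z)\<^sup>2)"
    unfolding cmod_power2 by (simp add: algebra_simps power2_eq_square)
  moreover have "\<dots> \<ge> 0"
    using assms by (intro mult_nonneg_nonneg) (simp_all add: power_mono power_le_one)
  ultimately have "(norm (a * z + b))\<^sup>2 \<le> (norm (cnj b * z + cnj a))\<^sup>2" by linarith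
  then have "norm (a * z + b) \<le> norm (cnj b * z + cnj a)" by (rule power2_le_imp_le) simp
  then show ?thesis
    using assms moebius_denominator[OF assms] by (simp add: disk_moebius_def norm_divide divide_le_eq_1)
qed

text \<open>Multiplicativity of the determinant
  \<open>(norm a)\<^sup>2 - (norm b)\<^sup>2\<close>.\<close>

lemma norm_moebius_product:
  assumes "norm b < norm a" "norm d < norm c"
  shows "norm (a * d + b * cnj c) < norm (a * c + b * cnj d)"
proof -
  have "(norm (a * c + b * cnj d))\<^sup>2 - (norm (a * d + b * cnj c))\<^sup>2
      = ((norm a)\<^sup>2 - (norm b)\<^sup>2) * ((norm c)\<^sup>2 - (norm d)\<^sup>2)"
    unfolding cmod_power2 by (simp add: algebra_simps power2_eq_square)
  moreover have "\<dots> > 0"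
    using assms by (intro mult_pos_pos) (simp_all add: power_strict_mono)
  ultimately show ?thesis
    using power2_less_imp_less[of "norm (a * d + b * cnj c)" "norm (a * c + b * cnj d)"] by simp
qed

lemma compose_moebius:
  assumes "norm b < norm a" "norm d < norm c"
  shows "compose (cball 0 1) (disk_moebius a b) (disk_moebius c d)
    = disk_moebius (a * c + b * cnj d) (a * d + b * cnj c)"
proof (rule extensionalityI)
  fix z :: complex assume z: "z \<in> cball 0 1"
  then have nz: "norm z \<le> 1" by simp
  define y where "y = disk_moebius c d z"
  have y: "norm y \<le> 1" using norm_moebius_le_1[OF assms(2) nz] by (simp add: y_def)
  note d1 = moebius_denominator[OF assms(2) nz] and d2 = moebius_denominator[OF assms(1) y]
  define N where "N = cnj d * z + cnj c"
  have yN: "y * N = c * z + d" using d1 nz by (simp add: y_def disk_moebius_def N_def)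
  have "compose (cball 0 1) (disk_moebius a b) (disk_moebius c d) z = (a * y + b) / (cnj b * y + cnj a)"
    using nz y by (simp add: compose_def y_def disk_moebius_def)
  also have "\<dots> = ((a * y + b) * N) / ((cnj b * y + cnj a) * N)"
    using d1 by (simp add: N_def)
  also have "(a * y + b) * N = a * (y * N) + b * N" by (simp add: algebra_simps)
  also have "(cnj b * y + cnj a) * N = cnj b * (y * N) + cnj a * N" by (simp add: algebra_simps)
  also have "(a * (y * N) + b * N) / (cnj b * (y * N) + cnj a * N)
     = disk_moebius (a * c + b * cnj d) (a * d + b * cnj c) z"
    unfolding yN using nz by (simp add: N_def disk_moebius_def algebra_simps)
  finally show "compose (cball 0 1) (disk_moebius a b) (disk_moebius c d) z
    = disk_moebius (a * c + b * cnj d) (a * d + b * cnj c) z" .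
qed (auto simp: disk_moebius_def)

lemma moebius_inverse:
  assumes "norm b < norm a"
  shows "compose (cball 0 1) (disk_moebius a b) (disk_moebius (cnj a) (- b)) = (\<lambda>z\<in>cball 0 1. z)"
    "compose (cball 0 1) (disk_moebius (cnj a) (- b)) (disk_moebius a b) = (\<lambda>z\<in>cball 0 1. z)"
proof -
  have *: "disk_moebius c 0 = (\<lambda>z\<in>cball 0 1. z)" if "c \<noteq> 0" "cnj c = c" for c
    using that by (auto simp: disk_moebius_def restrict_def fun_eq_iff)
  have "norm (b * cnj b) < norm (a * cnj a)"
    using assms by (simp add: norm_mult mult_strict_mono')
  then have "a * cnj a \<noteq> b * cnj b" by force
  then show "compose (cball 0 1) (disk_moebius a b) (disk_moebius (cnj a) (- b)) = (\<lambda>z\<in>cball 0 1. z)"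
    "compose (cball 0 1) (disk_moebius (cnj a) (- b)) (disk_moebius a b) = (\<lambda>z\<in>cball 0 1. z)"
    using assms by (simp_all add: compose_moebius * mult.commute)
qed

lemma moebius_inverse_apply:
  assumes "norm b < norm a" "z \<in> cball 0 1"
  shows "disk_moebius a b (disk_moebius (cnj a) (- b) z) = z" "disk_moebius (cnj a) (- b) (disk_moebius a b z) = z"
  using fun_cong[OF moebius_inverse(1)[OF assms(1)], of z]
    fun_cong[OF moebius_inverse(2)[OF assms(1)], of z] assms(2)
  by (simp_all add: compose_def)

lemma moebius_Bij:
  assumes "norm b < norm a"
  shows "disk_moebius a b \<in> Bij (cball 0 1)"
proof -
  have "bij_betw (disk_moebius a b) (cball 0 1) (cball 0 1)"
    by (rule bij_betw_byWitness[where f' = "disk_moebius (cnj a) (- b)"])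
      (use assms norm_moebius_le_1 moebius_inverse_apply in auto)
  then show ?thesis by (simp add: Bij_def disk_moebius_def)
qed

lemma moebius_ideal_point:
  assumes "norm b < norm a" "v \<noteq> 0"
  shows "disk_moebius a b (ideal_point v) = ideal_point (a * v + b * cnj v)"
proof -
  have "disk_moebius a b (ideal_point v) = (a * (v / cnj v) + b) / (cnj b * (v / cnj v) + cnj a)"
    using norm_ideal_point[OF assms(2)] by (simp add: disk_moebius_def ideal_point_def)
  also have "\<dots> = ((a * (v / cnj v) + b) * cnj v) / ((cnj b * (v / cnj v) + cnj a) * cnj v)"
    using assms(2) by simp
  also have "\<dots> = (a * v + b * cnj v) / (cnj b * v + cnj a * cnj v)"
    using assms(2) by (simp add: algebra_simps)
  finally show ?thesis by (simp add: ideal_point_def add.commute)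
qed

text \<open>The determinant of the linear lift. It is positive when \<open>norm b < norm a\<close>,
  so isometries preserve orientation.\<close>

lemma wedge_moebius:
  "wedge (a * v + b * cnj v) (a * w + b * cnj w) = ((norm a)\<^sup>2 - (norm b)\<^sup>2) * wedge v w"
  unfolding cmod_power2 by (simp add: wedge_eq algebra_simps power2_eq_square)

lemma moebius_vector_nonzero:
  assumes "norm b < norm a" "v \<noteq> 0"
  shows "a * v + b * cnj v \<noteq> 0"
proof
  assume "a * v + b * cnj v = 0"
  then have "norm (a * v) = norm (b * cnj v)" by (metis add_eq_0_iff norm_minus_cancel)
  with assms show False by (simp add: norm_mult)
qed

text \<open>The lift \<open>M\<close> is linear, so \<open>M u\<close> has the same coordinates with
  respect to \<open>M v\<close>, \<open>M w\<close> as \<open>u\<close> has with respect to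
  \<open>v\<close>, \<open>w\<close>, and a reflection only changes the sign of the second
  coordinate.\<close>

lemma moebius_geodesic_reflection:
  assumes "norm b < norm a" "wedge v w \<noteq> 0" "u \<noteq> 0"
  shows "disk_moebius a b (geodesic_reflection (ideal_point v) (ideal_point w) (ideal_point u))
    = geodesic_reflection (disk_moebius a b (ideal_point v)) (disk_moebius a b (ideal_point w))
        (disk_moebius a b (ideal_point u))"
proof -
  define M where "M = (\<lambda>v. a * v + b * cnj v)"
  have fM: "disk_moebius a b (ideal_point x) = ideal_point (M x)" if "x \<noteq> 0" for x
    using moebius_ideal_point[OF assms(1) that] by (simp add: M_def)
  define \<alpha> \<beta> where "\<alpha> = wedge u w / wedge v w" "\<beta> = wedge v u / wedge v w"
  have u: "u = of_real \<alpha> * v + of_real \<beta> * w"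
    unfolding \<alpha>_\<beta>_def by (rule wedge_expansion[OF assms(2)])
  have Mu: "M u = of_real \<alpha> * M v + of_real \<beta> * M w"
    by (subst u) (simp add: M_def algebra_simps)
  have nz: "\<alpha> \<noteq> 0 \<or> \<beta> \<noteq> 0" using u assms(3) by auto
  \<comment> \<open>\<open>fM\<close> applies to nonzero vectors only, and the reflected vector must
    be one of them.\<close>
  have "of_real \<alpha> * v - of_real \<beta> * w \<noteq> 0"
  proof
    assume *: "of_real \<alpha> * v - of_real \<beta> * w = 0"
    have "\<alpha> * wedge v w = wedge (of_real \<alpha> * v - of_real \<beta> * w) w"
      "\<beta> * wedge v w = - wedge v (of_real \<alpha> * v - of_real \<beta> * w)"
      by (simp_all add: wedge_eq algebra_simps)
    then have "\<alpha> * wedge v w = 0" "\<beta> * wedge v w = 0"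
      unfolding * by (simp_all add: wedge_def)
    with nz assms(2) show False by simp
  qed
  moreover have "M (of_real \<alpha> * v - of_real \<beta> * w) = of_real \<alpha> * M v - of_real \<beta> * M w"
    by (simp add: M_def algebra_simps)
  moreover have "wedge (M v) (M w) \<noteq> 0"
    using assms(1,2) by (simp add: M_def wedge_moebius)
  moreover have "v \<noteq> 0" "w \<noteq> 0" using wedge_nonzeroD[OF assms(2)] by auto
  ultimately show ?thesis
    using geodesic_reflection_ideal_point[OF assms(2) nz]
      geodesic_reflection_ideal_point[of "M v" "M w", OF _ nz] assms(3)
    by (simp add: fM Mu[symmetric] u[symmetric])
qed


section \<open>The modular group\<close>

lemma PSL2Z_E:
  assumes "f \<in> carrier PSL2Z"
  obtains a b where "f = disk_moebius a b" "norm b < norm a"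
  using assms unfolding PSL2Z_def disk_isometries_eq by auto

lemma PSL2Z_Bij: "f \<in> carrier PSL2Z \<Longrightarrow> f \<in> Bij (cball 0 1)"
  by (auto elim!: PSL2Z_E intro: moebius_Bij)

lemma PSL2Z_image_edges: "f \<in> carrier PSL2Z \<Longrightarrow> (`) f ` farey_edges = farey_edges"
  by (simp add: PSL2Z_def)

lemma PSL2Z_image_edge: "f \<in> carrier PSL2Z \<Longrightarrow> e \<in> farey_edges \<Longrightarrow> f ` e \<in> farey_edges"
  using PSL2Z_image_edges by blast

lemma PSL2Z_mult:
  assumes "f \<in> carrier PSL2Z" "g \<in> carrier PSL2Z"
  shows "f \<otimes>\<^bsub>PSL2Z\<^esub> g = compose (cball 0 1) f g"
  using assms[THEN PSL2Z_Bij] by (simp add: PSL2Z_def BijGroup_def)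

lemma compose_image: "T \<subseteq> S \<Longrightarrow> compose S f g ` T = f ` g ` T"
  by (force simp: compose_def)

lemma subgroup_PSL2Z: "subgroup (carrier PSL2Z) (BijGroup (cball 0 1))"
proof
  show "carrier PSL2Z \<subseteq> carrier (BijGroup (cball 0 1))"
    using PSL2Z_Bij by (auto simp: BijGroup_def)
  have "disk_moebius 1 0 \<in> carrier PSL2Z"
  proof -
    have "disk_moebius 1 0 ` e = e" if "e \<in> farey_edges" for e
      using farey_edge_subset[OF that] by (auto simp: disk_moebius_def image_iff)
    then have "(`) (disk_moebius 1 0) ` farey_edges = farey_edges" by simp
    moreover have "disk_moebius 1 0 \<in> disk_isometries" unfolding disk_isometries_eq by force
    ultimately show ?thesis by (simp add: PSL2Z_def)
  qed
  moreover have "disk_moebius 1 0 = (\<lambda>z\<in>cball 0 1. z)"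
    by (auto simp: disk_moebius_def restrict_def fun_eq_iff)
  ultimately show "\<one>\<^bsub>BijGroup (cball 0 1)\<^esub> \<in> carrier PSL2Z" by (simp add: BijGroup_def)
next
  fix f g assume f: "f \<in> carrier PSL2Z" and g: "g \<in> carrier PSL2Z"
  have "f \<otimes>\<^bsub>BijGroup (cball 0 1)\<^esub> g = compose (cball 0 1) f g"
    using f g by (simp add: PSL2Z_Bij BijGroup_def)
  moreover have "compose (cball 0 1) f g \<in> disk_isometries"
  proof -
    obtain a b where "f = disk_moebius a b" "norm b < norm a" using f by (rule PSL2Z_E)
    moreover obtain c d where "g = disk_moebius c d" "norm d < norm c" using g by (rule PSL2Z_E)
    ultimately show ?thesis
      using compose_moebius norm_moebius_product unfolding disk_isometries_eq by blast
  qed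
  moreover have "(`) (compose (cball 0 1) f g) ` farey_edges = (`) f ` (`) g ` farey_edges"
    unfolding image_image[of "(`) f" "(`) g"]
    by (intro image_cong refl compose_image farey_edge_subset)
  ultimately show "f \<otimes>\<^bsub>BijGroup (cball 0 1)\<^esub> g \<in> carrier PSL2Z"
    using PSL2Z_image_edges[OF f] PSL2Z_image_edges[OF g] by (simp add: PSL2Z_def)
next
  fix f assume f: "f \<in> carrier PSL2Z"
  obtain a b where ab: "f = disk_moebius a b" "norm b < norm a" using f by (rule PSL2Z_E)
  define g where "g = disk_moebius (cnj a) (- b)"
  have gB: "g \<in> Bij (cball 0 1)" using ab by (simp add: g_def moebius_Bij)
  have "inv\<^bsub>BijGroup (cball 0 1)\<^esub> f = g"
  proof (rule group.inv_equality[OF group_BijGroup])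
    show "g \<otimes>\<^bsub>BijGroup (cball 0 1)\<^esub> f = \<one>\<^bsub>BijGroup (cball 0 1)\<^esub>"
      using gB PSL2Z_Bij[OF f] moebius_inverse[OF ab(2)] by (simp add: BijGroup_def g_def ab)
  qed (use gB PSL2Z_Bij[OF f] in \<open>auto simp: BijGroup_def\<close>)
  moreover have "g \<in> disk_isometries"
    using ab(2) unfolding disk_isometries_eq g_def by force
  moreover have "(`) g ` farey_edges = farey_edges"
  proof -
    have "g ` f ` e = e" if "e \<in> farey_edges" for e
    proof -
      have "g (f z) = z" if "z \<in> e" for z
        using farey_edge_subset[OF \<open>e \<in> farey_edges\<close>] that ab(2) moebius_inverse_apply(2)
        unfolding g_def ab by blast
      then show ?thesis by (force simp: image_iff)
    qed
    then have "(`) g ` (`) f ` farey_edges = farey_edges" by (simp add: image_image)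
    then show ?thesis using PSL2Z_image_edges[OF f] by simp
  qed
  ultimately show "inv\<^bsub>BijGroup (cball 0 1)\<^esub> f \<in> carrier PSL2Z" by (simp add: PSL2Z_def)
qed

lemma group_PSL2Z: "group PSL2Z"
proof -
  have "PSL2Z = BijGroup (cball 0 1)\<lparr>carrier := carrier PSL2Z\<rparr>" by (simp add: PSL2Z_def)
  then show ?thesis
    using subgroup.subgroup_is_group[OF subgroup_PSL2Z group_BijGroup] by simp
qed

text \<open>Upgrades preservation of edges to preservation of oriented quadrilaterals. The lift
  sends \<open>v\<close>, \<open>w\<close> to \<open>c * v1\<close>, \<open>d * w1\<close> with
  \<open>c * d > 0\<close>, as its determinant is positive. Since \<open>v + w\<close> spans an edge
  with \<open>v\<close> and with \<open>w\<close>, the line of its image contains a lattice vector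
  \<open>u1\<close> whose determinants with \<open>v1\<close> and \<open>w1\<close> are
  \<open>1\<close> up to sign; this forces \<open>c = d\<close> up to sign, hence
  \<open>c = d\<close>. So the lift is a multiple of a map of bases and respects sums and
  differences.\<close>

lemma PSL2Z_unimodular:
  assumes f: "f \<in> carrier PSL2Z" and vw: "unimodular v w"
    and e: "{ideal_point v, ideal_point w} \<in> farey_edges"
  obtains v' w' where "unimodular v' w'" "f (ideal_point v) = ideal_point v'"
    "f (ideal_point w) = ideal_point w'" "f (ideal_point (v + w)) = ideal_point (v' + w')"
    "f (ideal_point (v - w)) = ideal_point (v' - w')"
proof -
  obtain a b where ab: "f = disk_moebius a b" "norm b < norm a" using f by (rule PSL2Z_E)
  define M where "M = (\<lambda>v. a * v + b * cnj v)"
  have fM: "f (ideal_point u) = ideal_point (M u)" if "u \<noteq> 0" for u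
    using moebius_ideal_point[OF ab(2) that] by (simp add: ab M_def)
  have M_nz: "M u \<noteq> 0" if "u \<noteq> 0" for u
    using moebius_vector_nonzero[OF ab(2) that] by (simp add: M_def)
  note vw_nz = unimodularD(1,2)[OF vw]
  have s_nz: "v + w \<noteq> 0" "v - w \<noteq> 0"
    using unimodularD[OF unimodular_transform(4)[OF vw]] unimodularD[OF unimodular_transform(5)[OF vw]]
    by auto
  have "{ideal_point (M v), ideal_point (M w)} \<in> farey_edges"
    using PSL2Z_image_edge[OF f e] vw_nz by (simp add: fM)
  then obtain v0 w0 where 0: "unimodular v0 w0"
    "{ideal_point (M v), ideal_point (M w)} = {ideal_point v0, ideal_point w0}"
    by (rule farey_edge_coordinates)
  \<comment> \<open>Matches the order of the image endpoints; exchanging the two vectors costs a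
    sign, to keep the determinant \<open>1\<close>.\<close>
  obtain v1 w1 where 1: "unimodular v1 w1" "ideal_point (M v) = ideal_point v1"
    "ideal_point (M w) = ideal_point w1"
  proof (cases "ideal_point (M v) = ideal_point v0")
    case True
    with 0 that[of v0 w0] show ?thesis by (auto simp: doubleton_eq_iff)
  next
    case False
    with 0 that[of w0 "- v0"] unimodular_transform(1)[OF 0(1)] show ?thesis
      by (auto simp: doubleton_eq_iff)
  qed
  note nz1 = unimodularD(1,2)[OF 1(1)]
  obtain c where c: "M v = of_real c * v1"
    by (rule same_ideal_point[OF nz1(1) M_nz[OF vw_nz(1)] 1(2)])
  obtain d where d: "M w = of_real d * w1"
    by (rule same_ideal_point[OF nz1(2) M_nz[OF vw_nz(2)] 1(3)])
  have w11: "wedge v1 w1 = 1" using 1 by (simp add: unimodular_def)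
  have "c * d = wedge (M v) (M w)"
    using w11 unfolding c d wedge_eq by (simp add: algebra_simps)
  also have "\<dots> > 0"
    using ab(2) vw by (simp add: M_def wedge_moebius unimodular_def power_strict_mono)
  finally have cd: "c * d > 0" .
  have M_add: "M (v + w) = of_real c * v1 + of_real d * w1"
    "M (v - w) = of_real c * v1 - of_real d * w1"
    unfolding c[symmetric] d[symmetric] by (simp_all add: M_def algebra_simps)
  have T: "triangle_sum v w \<in> farey_triangles" using e vw by (simp add: farey_edge_iff)
  have "{ideal_point v, ideal_point (v + w)} \<in> farey_edges"
    "{ideal_point w, ideal_point (v + w)} \<in> farey_edges"
    using unimodularD(3)[OF unimodular_transform(3)[OF vw]]
      unimodularD(3)[OF unimodular_transform(4)[OF vw]]
    by (intro farey_edgeI[OF T]; auto)+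
  from this[THEN PSL2Z_image_edge[OF f]]
  have edges: "{ideal_point v1, ideal_point (M (v + w))} \<in> farey_edges"
    "{ideal_point w1, ideal_point (M (v + w))} \<in> farey_edges"
    using vw_nz s_nz 1 by (simp_all add: fM)
  obtain u1 where u1: "unimodular v1 u1" "ideal_point (M (v + w)) = ideal_point u1"
    using 1(1) edges(1) by (rule farey_neighbour)
  obtain u2 where u2: "unimodular w1 u2" "ideal_point (M (v + w)) = ideal_point u2"
    using unimodular_transform(1)[OF 1(1)] edges(2) by (rule farey_neighbour)
  have "u2 = u1 \<or> u2 = - u1"
    using same_ideal_point_unimodular[OF unimodular_transform(1)[OF u1(1)]
        unimodular_transform(1)[OF u2(1)]] u1 u2 by simp
  then have wu1: "wedge u1 w1 = 1 \<or> wedge u1 w1 = -1"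
    using u2(1) by (auto simp: unimodular_def wedge_eq algebra_simps)
  have "wedge (M (v + w)) u1 = 0"
    using M_nz[OF s_nz(1)] u1 unimodularD(2)[OF u1(1)] by (simp add: ideal_point_eq_iff)
  moreover have "wedge (M (v + w)) u1 = c * wedge v1 u1 - d * wedge u1 w1"
    by (simp add: M_add wedge_eq algebra_simps)
  ultimately have "c = d * wedge u1 w1" using u1(1) by (simp add: unimodular_def)
  with wu1 cd have "c = d" "c \<noteq> 0"
    by (auto simp: zero_less_mult_iff)
  then have "M (v + w) = of_real c * (v1 + w1)" "M (v - w) = of_real c * (v1 - w1)"
    by (simp_all add: M_add algebra_simps)
  with \<open>c \<noteq> 0\<close> have "ideal_point (M (v + w)) = ideal_point (v1 + w1)"
    "ideal_point (M (v - w)) = ideal_point (v1 - w1)"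
    by (simp_all add: ideal_point_scaleR)
  with 1 show thesis
    using vw_nz s_nz by (intro that[of v1 w1]) (simp_all add: fM)
qed


section \<open>The once-punctured torus group\<close>

abbreviation lower_triangle :: "complex set" where "lower_triangle \<equiv> {1, -1, -\<i>}"
abbreviation upper_triangle :: "complex set" where "upper_triangle \<equiv> {1, -1, \<i>}"

definition torus_gen_a :: "complex \<Rightarrow> complex" where
  "torus_gen_a = disk_moebius (3/2) (1/2 + \<i>)"

definition torus_gen_b :: "complex \<Rightarrow> complex" where
  "torus_gen_b = disk_moebius (3/2) (-1/2 + \<i>)"

text \<open>In the lattice basis \<open>1, \<i>\<close> these are the matrices with columns \<open>(2,1), (1,1)\<close> and
  \<open>(1,1), (1,2)\<close>.\<close>

lemma norm_torus_coefficients: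
  "norm (1/2 + \<i>) < norm (3/2 :: complex)" "norm (-1/2 + \<i>) < norm (3/2 :: complex)"
proof -
  have *: "(norm (1/2 + \<i>))\<^sup>2 < (norm (3/2 :: complex))\<^sup>2" "(norm (-1/2 + \<i>))\<^sup>2 < (norm (3/2 :: complex))\<^sup>2"
    unfolding cmod_power2 by (simp_all add: power2_eq_square)
  show "norm (1/2 + \<i>) < norm (3/2 :: complex)"
    using *(1) by (rule power2_less_imp_less) simp
  show "norm (-1/2 + \<i>) < norm (3/2 :: complex)"
    using *(2) by (rule power2_less_imp_less) simp
qed

lemma norm_torus_coefficients_inverse:
  "norm (- (1/2 + \<i>)) < norm (cnj (3/2))" "norm (- (-1/2 + \<i>)) < norm (cnj (3/2))"
  using norm_torus_coefficients unfolding norm_minus_cancel complex_mod_cnj by simp_all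

lemma torus_gen_a_ideal_point:
  "v \<noteq> 0 \<Longrightarrow> torus_gen_a (ideal_point v) = ideal_point (3/2 * v + (1/2 + \<i>) * cnj v)"
  unfolding torus_gen_a_def by (rule moebius_ideal_point[OF norm_torus_coefficients(1)])

lemma torus_gen_b_ideal_point:
  "v \<noteq> 0 \<Longrightarrow> torus_gen_b (ideal_point v) = ideal_point (3/2 * v + (-1/2 + \<i>) * cnj v)"
  unfolding torus_gen_b_def by (rule moebius_ideal_point[OF norm_torus_coefficients(2)])

text \<open>The point of \<open>1 - 2 * \<i>\<close> is the third vertex of the triangle beyond the
  side from \<open>-1\<close> to \<open>-\<i>\<close>; the generator takes that triangle to the
  upper one. The point of \<open>2 - \<i>\<close> has the same role for \<open>torus_gen_b\<close>
  and the side from \<open>-\<i>\<close> to \<open>1\<close>.\<close>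

lemma torus_gen_a_values:
  "torus_gen_a 1 = ideal_point (2 + \<i>)" "torus_gen_a (-1) = \<i>" "torus_gen_a (-\<i>) = 1"
  "torus_gen_a (ideal_point (1 - 2 * \<i>)) = -1"
proof -
  have "ideal_point (- \<i>) = -1" by simp
  moreover have "1 - 2 * \<i> \<noteq> 0" "1 - \<i> \<noteq> 0" by (simp_all add: complex_eq_iff)
  moreover have "3/2 + (1/2 + \<i>) = 2 + \<i>" "3/2 * \<i> + (1/2 + \<i>) * cnj \<i> = 1 + \<i>"
    "3/2 * (1 - \<i>) + (1/2 + \<i>) * cnj (1 - \<i>) = 1"
    "3/2 * (1 - 2 * \<i>) + (1/2 + \<i>) * cnj (1 - 2 * \<i>) = - \<i>"
    by (simp_all add: complex_eq_iff)
  ultimately show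
    "torus_gen_a 1 = ideal_point (2 + \<i>)" "torus_gen_a (-1) = \<i>" "torus_gen_a (-\<i>) = 1"
    "torus_gen_a (ideal_point (1 - 2 * \<i>)) = -1"
    using torus_gen_a_ideal_point[of 1] torus_gen_a_ideal_point[of \<i>]
      torus_gen_a_ideal_point[of "1 - \<i>"] torus_gen_a_ideal_point[of "1 - 2 * \<i>"]
    by (simp_all only: ideal_point_simps complex_cnj_one mult_1_right) simp_all
qed

lemma torus_gen_b_values:
  "torus_gen_b 1 = \<i>" "torus_gen_b (-1) = ideal_point (1 + 2 * \<i>)" "torus_gen_b (-\<i>) = -1"
  "torus_gen_b (ideal_point (2 - \<i>)) = 1"
proof -
  have "ideal_point (- \<i>) = -1" by simp
  moreover have "2 - \<i> \<noteq> 0" "1 - \<i> \<noteq> 0" by (simp_all add: complex_eq_iff)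
  moreover have "3/2 + (-1/2 + \<i>) = 1 + \<i>" "3/2 * \<i> + (-1/2 + \<i>) * cnj \<i> = 1 + 2 * \<i>"
    "3/2 * (1 - \<i>) + (-1/2 + \<i>) * cnj (1 - \<i>) = - \<i>"
    "3/2 * (2 - \<i>) + (-1/2 + \<i>) * cnj (2 - \<i>) = 1"
    by (simp_all add: complex_eq_iff)
  ultimately show
    "torus_gen_b 1 = \<i>" "torus_gen_b (-1) = ideal_point (1 + 2 * \<i>)" "torus_gen_b (-\<i>) = -1"
    "torus_gen_b (ideal_point (2 - \<i>)) = 1"
    using torus_gen_b_ideal_point[of 1] torus_gen_b_ideal_point[of \<i>]
      torus_gen_b_ideal_point[of "1 - \<i>"] torus_gen_b_ideal_point[of "2 - \<i>"]
    by (simp_all only: ideal_point_simps complex_cnj_one mult_1_right) simp_all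
qed

lemma unimodular_simps:
  "unimodular 1 \<i>" "unimodular 1 (1 + \<i>)" "unimodular (1 - \<i>) \<i>" "unimodular (1 + \<i>) \<i>"
  "unimodular (1 - \<i>) 1"
  by (simp_all add: unimodular_def gaussian_def wedge_eq)

lemma geodesic_reflection_commute: "geodesic_reflection p q = geodesic_reflection q p"
  by (simp add: geodesic_reflection_def fun_eq_iff algebra_simps)

text \<open>All six reflections of the two triangles of the fundamental quadrilateral in their
  sides. Beyond the upper sides lie translates of the lower triangle; the explicit triangles beyond
  the lower sides are identified below as translates of the upper triangle by the inverse
  generators.\<close>

lemma reflected_fundamental_triangles:
  "geodesic_reflection 1 (-1) ` lower_triangle = upper_triangle"
  "geodesic_reflection 1 (-1) ` upper_triangle = lower_triangle"
  "geodesic_reflection (-1) (-\<i>) ` lower_triangle = {ideal_point (1 - 2 * \<i>), -\<i>, -1}"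
  "geodesic_reflection (-\<i>) 1 ` lower_triangle = {ideal_point (2 - \<i>), -\<i>, 1}"
  "geodesic_reflection 1 \<i> ` upper_triangle = torus_gen_a ` lower_triangle"
  "geodesic_reflection \<i> (-1) ` upper_triangle = torus_gen_b ` lower_triangle"
proof -
  have m: "ideal_point (- \<i>) = -1" by simp
  have s: "1 - \<i> + \<i> = 1" "1 - \<i> - \<i> = 1 - 2 * \<i>" "1 - \<i> + 1 = 2 - \<i>" "1 - \<i> - 1 = - \<i>"
    "1 + (1 + \<i>) = 2 + \<i>" "1 - (1 + \<i>) = - \<i>" "1 + \<i> + \<i> = 1 + 2 * \<i>" "1 + \<i> - \<i> = 1"
    by simp_all
  note r = reflected_triangle_sum[OF unimodular_simps(1)] reflected_triangle_sum[OF unimodular_simps(2)]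
    reflected_triangle_sum[OF unimodular_simps(3)] reflected_triangle_sum[OF unimodular_simps(4)]
    reflected_triangle_sum[OF unimodular_simps(5)]
  note r' = r[unfolded s, unfolded ideal_point_simps m]
  show "geodesic_reflection 1 (-1) ` lower_triangle = upper_triangle"
    "geodesic_reflection 1 (-1) ` upper_triangle = lower_triangle"
    "geodesic_reflection (-1) (-\<i>) ` lower_triangle = {ideal_point (1 - 2 * \<i>), -\<i>, -1}"
    "geodesic_reflection (-\<i>) 1 ` lower_triangle = {ideal_point (2 - \<i>), -\<i>, 1}"
    "geodesic_reflection 1 \<i> ` upper_triangle = torus_gen_a ` lower_triangle"
    "geodesic_reflection \<i> (-1) ` upper_triangle = torus_gen_b ` lower_triangle"
    unfolding image_insert torus_gen_a_values torus_gen_b_values image_empty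
    using r' by (simp_all add: insert_commute geodesic_reflection_commute)
qed

section \<open>The side pairings preserve the tesselation\<close>

lemma lower_triangle_farey: "lower_triangle \<in> farey_triangles"
  by (rule farey_triangles.initial)

lemma upper_triangle_farey: "upper_triangle \<in> farey_triangles"
  using farey_triangles.reflected[OF lower_triangle_farey, of 1 "-1"]
  by (simp only: reflected_fundamental_triangles) simp

lemma moebius_reflected_triangle:
  assumes "norm b < norm a" "T \<in> farey_triangles" "p \<in> T" "q \<in> T" "p \<noteq> q"
  shows "disk_moebius a b ` geodesic_reflection p q ` T
    = geodesic_reflection (disk_moebius a b p) (disk_moebius a b q) ` disk_moebius a b ` T"
proof -
  obtain v w where vw: "unimodular v w" "p = ideal_point v" "q = ideal_point w"
    using assms(2-5) by (rule farey_triangle_side)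
  then have "wedge v w \<noteq> 0" by (simp add: unimodular_def)
  have "disk_moebius a b (geodesic_reflection p q z)
      = geodesic_reflection (disk_moebius a b p) (disk_moebius a b q) (disk_moebius a b z)"
    if "z \<in> T" for z
  proof -
    obtain u where "u \<noteq> 0" "z = ideal_point u"
      using assms(2) \<open>z \<in> T\<close> by (rule farey_triangle_points)
    then show ?thesis
      using moebius_geodesic_reflection[OF assms(1) \<open>wedge v w \<noteq> 0\<close>] vw by simp
  qed
  then show ?thesis by (simp add: image_image)
qed

text \<open>An isometry conjugates reflections to reflections, so induction along the reflections
  needs a single known image. Either fundamental triangle serves, as they are mirror images; the
  generators are controlled on the lower one, their inverses on the upper one.\<close>

lemma moebius_farey_triangle:
  assumes ab: "norm b < norm a"
    and base: "disk_moebius a b ` lower_triangle \<in> farey_triangles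
      \<or> disk_moebius a b ` upper_triangle \<in> farey_triangles"
    and T: "T \<in> farey_triangles"
  shows "disk_moebius a b ` T \<in> farey_triangles"
proof -
  have inj: "disk_moebius a b p \<noteq> disk_moebius a b q"
    if "T \<in> farey_triangles" "p \<in> T" "q \<in> T" "p \<noteq> q" for T p q
    using that farey_triangle_subset[OF that(1)] moebius_inverse_apply(2)[OF ab] by (metis subsetD)
  have step: "disk_moebius a b ` geodesic_reflection p q ` T \<in> farey_triangles"
    if "T \<in> farey_triangles" "disk_moebius a b ` T \<in> farey_triangles" "p \<in> T" "q \<in> T" "p \<noteq> q" for T p q
    using that inj[of T p q]
    by (simp add: moebius_reflected_triangle[OF ab] farey_triangles.reflected)
  have "disk_moebius a b ` lower_triangle \<in> farey_triangles"
    using base step[OF upper_triangle_farey, of 1 "-1"]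
    unfolding reflected_fundamental_triangles by auto
  with T show ?thesis
    by (induction rule: farey_triangles.induct) (simp_all add: step)
qed

text \<open>The condition on the map shows that edges go to edges, the one on the inverse map that
  every edge is hit.\<close>

lemma moebius_in_PSL2Z:
  assumes ab: "norm b < norm a"
    and T: "\<And>T. T \<in> farey_triangles \<Longrightarrow> disk_moebius a b ` T \<in> farey_triangles"
    and T': "\<And>T. T \<in> farey_triangles \<Longrightarrow> disk_moebius (cnj a) (- b) ` T \<in> farey_triangles"
  shows "disk_moebius a b \<in> carrier PSL2Z"
proof -
  have edge: "f ` e \<in> farey_edges"
    if f: "f \<in> Bij (cball 0 1)" "\<And>T. T \<in> farey_triangles \<Longrightarrow> f ` T \<in> farey_triangles"
      and e: "e \<in> farey_edges" for f e
  proof -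
    obtain p q T where pqT: "e = {p, q}" "p \<noteq> q" "T \<in> farey_triangles" "p \<in> T" "q \<in> T"
      using e unfolding farey_edges_def by blast
    then have "f p \<noteq> f q"
      using f(1) farey_triangle_subset[OF pqT(3)] by (auto simp: Bij_def bij_betw_def inj_on_def)
    with pqT f(2) show ?thesis
      by (auto intro!: farey_edgeI[of "f ` T"])
  qed
  have "disk_moebius a b ` e \<in> farey_edges" if "e \<in> farey_edges" for e
    using edge[OF moebius_Bij[OF ab] T] that by blast
  moreover have "e \<in> (`) (disk_moebius a b) ` farey_edges" if "e \<in> farey_edges" for e
  proof -
    have "norm (- b) < norm (cnj a)" using ab by simp
    then have "disk_moebius (cnj a) (- b) ` e \<in> farey_edges"
      using edge[OF moebius_Bij T'] that by blast
    moreover have "disk_moebius a b (disk_moebius (cnj a) (- b) z) = z" if "z \<in> e" for z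
      using that moebius_inverse_apply(1)[OF ab] farey_edge_subset[OF \<open>e \<in> farey_edges\<close>] by blast
    then have "e = disk_moebius a b ` disk_moebius (cnj a) (- b) ` e"
      by (simp add: image_image)
    ultimately show ?thesis by blast
  qed
  ultimately have "(`) (disk_moebius a b) ` farey_edges = farey_edges" by blast
  moreover have "disk_moebius a b \<in> disk_isometries"
    using ab unfolding disk_isometries_eq by blast
  ultimately show ?thesis by (simp add: PSL2Z_def)
qed

lemma inv_PSL2Z_moebius:
  assumes "norm b < norm a" "disk_moebius a b \<in> carrier PSL2Z" "disk_moebius (cnj a) (- b) \<in> carrier PSL2Z"
  shows "inv\<^bsub>PSL2Z\<^esub> (disk_moebius a b) = disk_moebius (cnj a) (- b)"
proof (rule group.inv_equality[OF group_PSL2Z])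
  show "disk_moebius (cnj a) (- b) \<otimes>\<^bsub>PSL2Z\<^esub> disk_moebius a b = \<one>\<^bsub>PSL2Z\<^esub>"
    using assms by (simp add: PSL2Z_mult moebius_inverse) (simp add: PSL2Z_def BijGroup_def)
qed (use assms in auto)

abbreviation torus_gen_a_inv :: "complex \<Rightarrow> complex" where
  "torus_gen_a_inv \<equiv> disk_moebius (cnj (3/2)) (- (1/2 + \<i>))"

abbreviation torus_gen_b_inv :: "complex \<Rightarrow> complex" where
  "torus_gen_b_inv \<equiv> disk_moebius (cnj (3/2)) (- (-1/2 + \<i>))"

lemma ideal_point_2_i_in_cball:
  "ideal_point (1 - 2 * \<i>) \<in> cball 0 1" "ideal_point (2 - \<i>) \<in> cball 0 1"
proof -
  have "1 - 2 * \<i> \<noteq> 0" "2 - \<i> \<noteq> 0" by (simp_all add: complex_eq_iff)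
  from this[THEN norm_ideal_point]
  show "ideal_point (1 - 2 * \<i>) \<in> cball 0 1" "ideal_point (2 - \<i>) \<in> cball 0 1" by simp_all
qed

lemma torus_gen_a_inv_image:
  "torus_gen_a_inv ` upper_triangle = geodesic_reflection (-1) (-\<i>) ` lower_triangle"
proof -
  have "upper_triangle = torus_gen_a ` {ideal_point (1 - 2 * \<i>), -\<i>, -1}"
    by (auto simp: torus_gen_a_values)
  moreover have "torus_gen_a_inv ` torus_gen_a ` {ideal_point (1 - 2 * \<i>), -\<i>, -1}
    = {ideal_point (1 - 2 * \<i>), -\<i>, -1}"
    using moebius_inverse_apply(2)[OF norm_torus_coefficients(1)] ideal_point_2_i_in_cball
    unfolding torus_gen_a_def image_insert image_empty by simp
  ultimately show ?thesis unfolding reflected_fundamental_triangles by simp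
qed

lemma torus_gen_b_inv_image:
  "torus_gen_b_inv ` upper_triangle = geodesic_reflection (-\<i>) 1 ` lower_triangle"
proof -
  have "upper_triangle = torus_gen_b ` {ideal_point (2 - \<i>), -\<i>, 1}"
    by (auto simp: torus_gen_b_values)
  moreover have "torus_gen_b_inv ` torus_gen_b ` {ideal_point (2 - \<i>), -\<i>, 1}
    = {ideal_point (2 - \<i>), -\<i>, 1}"
    using moebius_inverse_apply(2)[OF norm_torus_coefficients(2)] ideal_point_2_i_in_cball
    unfolding torus_gen_b_def image_insert image_empty by simp
  ultimately show ?thesis unfolding reflected_fundamental_triangles by simp
qed

lemma torus_generators_preserve:
  assumes T: "T \<in> farey_triangles"
  shows "torus_gen_a ` T \<in> farey_triangles" "torus_gen_b ` T \<in> farey_triangles"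
    "torus_gen_a_inv ` T \<in> farey_triangles" "torus_gen_b_inv ` T \<in> farey_triangles"
proof -
  have "torus_gen_a ` lower_triangle \<in> farey_triangles"
    using farey_triangles.reflected[OF upper_triangle_farey, of 1 \<i>]
    unfolding reflected_fundamental_triangles by (simp add: complex_eq_iff)
  then show "torus_gen_a ` T \<in> farey_triangles"
    unfolding torus_gen_a_def using T by (intro moebius_farey_triangle norm_torus_coefficients) auto
  have "torus_gen_b ` lower_triangle \<in> farey_triangles"
    using farey_triangles.reflected[OF upper_triangle_farey, of \<i> "-1"]
    unfolding reflected_fundamental_triangles by (simp add: complex_eq_iff)
  then show "torus_gen_b ` T \<in> farey_triangles"
    unfolding torus_gen_b_def using T by (intro moebius_farey_triangle norm_torus_coefficients) auto
  have "torus_gen_a_inv ` upper_triangle \<in> farey_triangles"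
    unfolding torus_gen_a_inv_image
    by (rule farey_triangles.reflected[OF lower_triangle_farey]) (simp_all add: complex_eq_iff)
  then show "torus_gen_a_inv ` T \<in> farey_triangles"
    using T by (intro moebius_farey_triangle norm_torus_coefficients_inverse) auto
  have "torus_gen_b_inv ` upper_triangle \<in> farey_triangles"
    unfolding torus_gen_b_inv_image
    by (rule farey_triangles.reflected[OF lower_triangle_farey]) (simp_all add: complex_eq_iff)
  then show "torus_gen_b_inv ` T \<in> farey_triangles"
    using T by (intro moebius_farey_triangle norm_torus_coefficients_inverse) auto
qed

lemma torus_generators_PSL2Z:
  "torus_gen_a \<in> carrier PSL2Z" "torus_gen_b \<in> carrier PSL2Z"
  "torus_gen_a_inv \<in> carrier PSL2Z" "torus_gen_b_inv \<in> carrier PSL2Z"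
proof -
  note p = torus_generators_preserve[unfolded torus_gen_a_def torus_gen_b_def]
  note c = norm_torus_coefficients and c' = norm_torus_coefficients_inverse
  show "torus_gen_a \<in> carrier PSL2Z" "torus_gen_b \<in> carrier PSL2Z"
    unfolding torus_gen_a_def torus_gen_b_def
    by (rule moebius_in_PSL2Z[OF c(1) p(1,3)] moebius_in_PSL2Z[OF c(2) p(2,4)]; assumption)+
  show "torus_gen_a_inv \<in> carrier PSL2Z"
    by (rule moebius_in_PSL2Z[OF c'(1), unfolded complex_cnj_cnj minus_minus, OF p(3,1)])
  show "torus_gen_b_inv \<in> carrier PSL2Z"
    by (rule moebius_in_PSL2Z[OF c'(2), unfolded complex_cnj_cnj minus_minus, OF p(4,2)])
qed

section \<open>Orbits of the torus group on triangles and edges\<close>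

lemma torus_side_pairings_subset: "torus_side_pairings \<subseteq> carrier PSL2Z"
  by (auto simp: torus_side_pairings_def)

lemma group_torus_group: "group torus_group"
proof -
  have "subgroup (generate PSL2Z torus_side_pairings) PSL2Z"
    using group_PSL2Z torus_side_pairings_subset by (rule group.generate_is_subgroup)
  then show ?thesis
    unfolding torus_group_def using group_PSL2Z by (rule subgroup.subgroup_is_group)
qed

lemma torus_group_subset: "g \<in> carrier torus_group \<Longrightarrow> g \<in> carrier PSL2Z"
  using group.generate_in_carrier[OF group_PSL2Z torus_side_pairings_subset]
  by (simp add: torus_group_def)

lemma torus_group_mult:
  assumes "g \<in> carrier torus_group" "h \<in> carrier torus_group"
  shows "g \<otimes>\<^bsub>torus_group\<^esub> h = compose (cball 0 1) g h"
  using assms[THEN torus_group_subset] PSL2Z_mult by (simp add: torus_group_def)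

lemma torus_group_mult_image:
  assumes "g \<in> carrier torus_group" "h \<in> carrier torus_group" "T \<subseteq> cball 0 1"
  shows "(g \<otimes>\<^bsub>torus_group\<^esub> h) ` T = g ` h ` T"
  using assms by (simp add: torus_group_mult compose_image)

lemma torus_group_one_image: "T \<subseteq> cball 0 1 \<Longrightarrow> \<one>\<^bsub>torus_group\<^esub> ` T = T"
  by (auto simp: torus_group_def PSL2Z_def BijGroup_def image_iff subset_iff)

lemma torus_generators:
  "torus_gen_a \<in> carrier torus_group" "torus_gen_b \<in> carrier torus_group"
  "torus_gen_a_inv \<in> carrier torus_group" "torus_gen_b_inv \<in> carrier torus_group"
proof -
  have *: "torus_gen_a \<in> torus_side_pairings" "torus_gen_b \<in> torus_side_pairings"
    using torus_generators_PSL2Z torus_gen_a_values torus_gen_b_values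
    by (auto simp: torus_side_pairings_def)
  then show "torus_gen_a \<in> carrier torus_group" "torus_gen_b \<in> carrier torus_group"
    by (auto simp: torus_group_def intro: generate.incl)
  have "inv\<^bsub>PSL2Z\<^esub> torus_gen_a = torus_gen_a_inv" "inv\<^bsub>PSL2Z\<^esub> torus_gen_b = torus_gen_b_inv"
    using inv_PSL2Z_moebius[OF norm_torus_coefficients(1)] inv_PSL2Z_moebius[OF norm_torus_coefficients(2)]
      torus_generators_PSL2Z unfolding torus_gen_a_def torus_gen_b_def by blast+
  then show "torus_gen_a_inv \<in> carrier torus_group" "torus_gen_b_inv \<in> carrier torus_group"
    using *[THEN generate.inv, of PSL2Z] by (simp_all add: torus_group_def)
qed

lemma torus_group_one:
  "\<one>\<^bsub>torus_group\<^esub> \<in> carrier torus_group"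
  "\<one>\<^bsub>torus_group\<^esub> ` lower_triangle = lower_triangle"
  "\<one>\<^bsub>torus_group\<^esub> ` upper_triangle = upper_triangle"
  using group.is_monoid[OF group_torus_group] lower_triangle_farey upper_triangle_farey
  by (simp_all only: monoid.one_closed torus_group_one_image[OF farey_triangle_subset])

text \<open>Crossing the diagonal of the fundamental quadrilateral leads to its other triangle;
  crossing one of the four outer sides leads to a translate by a side pairing or its
  inverse.\<close>

lemma fundamental_triangle_neighbour:
  assumes "T = lower_triangle \<or> T = upper_triangle" "p \<in> T" "q \<in> T" "p \<noteq> q"
  shows "\<exists>h\<in>carrier torus_group. geodesic_reflection p q ` T = h ` lower_triangle
     \<or> geodesic_reflection p q ` T = h ` upper_triangle"
proof -
  note r = reflected_fundamental_triangles(1,2,5,6) torus_gen_a_inv_image[symmetric]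
    torus_gen_b_inv_image[symmetric]
  have "geodesic_reflection p q ` T \<in> {lower_triangle, upper_triangle, torus_gen_a ` lower_triangle,
     torus_gen_b ` lower_triangle, torus_gen_a_inv ` upper_triangle, torus_gen_b_inv ` upper_triangle}"
    using assms(1)
  proof
    assume T: "T = lower_triangle"
    then consider "(p = 1 \<and> q = -1) \<or> (p = -1 \<and> q = 1)" | "(p = -1 \<and> q = -\<i>) \<or> (p = -\<i> \<and> q = -1)"
      | "(p = -\<i> \<and> q = 1) \<or> (p = 1 \<and> q = -\<i>)" using assms(2-4) by blast
    then show ?thesis
    proof cases
      case 1
      then have "geodesic_reflection p q = geodesic_reflection 1 (-1)"
        by (elim disjE conjE) (simp_all only: geodesic_reflection_commute)
      then show ?thesis by (simp only: T r insert_iff simp_thms)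
    next
      case 2
      then have "geodesic_reflection p q = geodesic_reflection (-1) (-\<i>)"
        by (elim disjE conjE) (simp_all only: geodesic_reflection_commute)
      then show ?thesis by (simp only: T r insert_iff simp_thms)
    next
      case 3
      then have "geodesic_reflection p q = geodesic_reflection (-\<i>) 1"
        by (elim disjE conjE) (simp_all only: geodesic_reflection_commute)
      then show ?thesis by (simp only: T r insert_iff simp_thms)
    qed
  next
    assume T: "T = upper_triangle"
    then consider "(p = 1 \<and> q = -1) \<or> (p = -1 \<and> q = 1)" | "(p = 1 \<and> q = \<i>) \<or> (p = \<i> \<and> q = 1)"
      | "(p = \<i> \<and> q = -1) \<or> (p = -1 \<and> q = \<i>)" using assms(2-4) by blast
    then show ?thesis
    proof cases
      case 1
      then have "geodesic_reflection p q = geodesic_reflection 1 (-1)"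
        by (elim disjE conjE) (simp_all only: geodesic_reflection_commute)
      then show ?thesis by (simp only: T r insert_iff simp_thms)
    next
      case 2
      then have "geodesic_reflection p q = geodesic_reflection 1 \<i>"
        by (elim disjE conjE) (simp_all only: geodesic_reflection_commute)
      then show ?thesis by (simp only: T r insert_iff simp_thms)
    next
      case 3
      then have "geodesic_reflection p q = geodesic_reflection \<i> (-1)"
        by (elim disjE conjE) (simp_all only: geodesic_reflection_commute)
      then show ?thesis by (simp only: T r insert_iff simp_thms)
    qed
  qed
  moreover have via: ?thesis
    if "h \<in> carrier torus_group" "geodesic_reflection p q ` T = h ` lower_triangle
      \<or> geodesic_reflection p q ` T = h ` upper_triangle" for h
    using that by (intro bexI)
  ultimately show ?thesis
  proof (elim insertE emptyE)
    assume "geodesic_reflection p q ` T = lower_triangle"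
    then show ?thesis by (intro via[OF torus_group_one(1)]) (simp only: torus_group_one simp_thms)
  next
    assume "geodesic_reflection p q ` T = upper_triangle"
    then show ?thesis by (intro via[OF torus_group_one(1)]) (simp only: torus_group_one simp_thms)
  qed (rule via[OF torus_generators(1)] via[OF torus_generators(2)] via[OF torus_generators(3)]
      via[OF torus_generators(4)], simp only: simp_thms)+
qed

text \<open>Since \<open>g\<close> conjugates reflections, a neighbour of a translate is the
  translate of a neighbour of a fundamental triangle, and \<open>g\<close> only acquires a further
  factor on the right.\<close>

lemma farey_triangle_orbit:
  assumes "T \<in> farey_triangles"
  shows "\<exists>g\<in>carrier torus_group. T = g ` lower_triangle \<or> T = g ` upper_triangle"
  using assms
proof induction
  case initial
  show ?case using torus_group_one by metis
next
  case (reflected T p q)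
  then obtain g T0 where g: "g \<in> carrier torus_group" and T: "T = g ` T0"
    and T0: "T0 = lower_triangle \<or> T0 = upper_triangle" by blast
  then have T0f: "T0 \<in> farey_triangles" using lower_triangle_farey upper_triangle_farey by auto
  obtain p0 q0 where p0: "p = g p0" "p0 \<in> T0" and q0: "q = g q0" "q0 \<in> T0"
    using reflected.hyps T by auto
  with reflected.hyps have ne: "p0 \<noteq> q0" by auto
  obtain h T1 where h: "h \<in> carrier torus_group" "geodesic_reflection p0 q0 ` T0 = h ` T1"
    and T1: "T1 = lower_triangle \<or> T1 = upper_triangle"
    using fundamental_triangle_neighbour[OF T0 p0(2) q0(2) ne] by blast
  obtain a b where ab: "g = disk_moebius a b" "norm b < norm a"
    using torus_group_subset[OF g] by (rule PSL2Z_E)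
  have "geodesic_reflection p q ` T = g ` geodesic_reflection p0 q0 ` T0"
    using moebius_reflected_triangle[OF ab(2) T0f p0(2) q0(2) ne] T p0 q0 ab(1) by simp
  also have "\<dots> = (g \<otimes>\<^bsub>torus_group\<^esub> h) ` T1"
    unfolding h(2) using g h(1) T1 by (subst torus_group_mult_image) auto
  finally show ?case
    using T1 group.subgroup_self[OF group_torus_group, THEN subgroup.m_closed, OF g h(1)] by metis
qed

text \<open>The quadrilateral with its diagonal has five edges; the two upper sides are images of
  the lower ones under the generators, which leaves three representatives.\<close>

lemma farey_edge_orbit:
  assumes "e \<in> farey_edges"
  obtains g e0 where "g \<in> carrier torus_group" "e0 \<in> {{1, -1}, {-1, -\<i>}, {-\<i>, 1}}" "e = g ` e0"
proof -
  obtain p q T where e: "e = {p, q}" "p \<noteq> q" "T \<in> farey_triangles" "p \<in> T" "q \<in> T"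
    using assms unfolding farey_edges_def by blast
  obtain g where g: "g \<in> carrier torus_group" "T = g ` lower_triangle \<or> T = g ` upper_triangle"
    using farey_triangle_orbit[OF e(3)] by blast
  have gen: "{1, \<i>} = torus_gen_a ` {-1, -\<i>}" "{\<i>, -1} = torus_gen_b ` {-\<i>, 1}"
    by (auto simp: torus_gen_a_values torus_gen_b_values)
  have mult: "g \<otimes>\<^bsub>torus_group\<^esub> torus_gen_a \<in> carrier torus_group"
    "g \<otimes>\<^bsub>torus_group\<^esub> torus_gen_b \<in> carrier torus_group"
    using group.subgroup_self[OF group_torus_group, THEN subgroup.m_closed, OF g(1)] torus_generators
    by auto
  have coords: thesis if T: "T = g ` T0" and R: "\<And>p0 q0. p0 \<in> T0 \<Longrightarrow> q0 \<in> T0 \<Longrightarrow> e = g ` {p0, q0} \<Longrightarrow> p0 \<noteq> q0 \<Longrightarrow> thesis"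
    for T0 thesis
  proof -
    obtain p0 q0 where "p0 \<in> T0" "p = g p0" "q0 \<in> T0" "q = g q0"
      using e(4,5) unfolding T by blast
    with e(1,2) R[of p0 q0] show thesis by auto
  qed
  from g(2) consider (lower) "T = g ` lower_triangle" | (upper) "T = g ` upper_triangle" by blast
  then show thesis
  proof cases
    case lower
    obtain p0 q0 where "p0 \<in> lower_triangle" "q0 \<in> lower_triangle" "e = g ` {p0, q0}" "p0 \<noteq> q0"
      using coords[OF lower] .
    moreover from this have "{p0, q0} \<in> {{1, -1}, {-1, -\<i>}, {-\<i>, 1}}" by (auto simp: insert_commute)
    ultimately show ?thesis using that g(1) by blast
  next
    case upper
    obtain p0 q0 where pq: "p0 \<in> upper_triangle" "q0 \<in> upper_triangle" "e = g ` {p0, q0}" "p0 \<noteq> q0"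
      using coords[OF upper] .
    then have "{p0, q0} \<in> {{1, -1}, {1, \<i>}, {\<i>, -1}}" by (auto simp: insert_commute)
    then consider "{p0, q0} = {1, -1}" | "{p0, q0} = torus_gen_a ` {-1, -\<i>}"
      | "{p0, q0} = torus_gen_b ` {-\<i>, 1}" using gen by (metis insertE singletonD)
    then show ?thesis
    proof cases
      case 1
      with pq g(1) that show ?thesis by blast
    next
      case 2
      have "e = (g \<otimes>\<^bsub>torus_group\<^esub> torus_gen_a) ` {-1, -\<i>}"
        using g torus_generators unfolding pq(3) 2 by (subst torus_group_mult_image) auto
      with mult(1) that show ?thesis by blast
    next
      case 3
      have "e = (g \<otimes>\<^bsub>torus_group\<^esub> torus_gen_b) ` {-\<i>, 1}"
        using g torus_generators unfolding pq(3) 3 by (subst torus_group_mult_image) auto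
      with mult(2) that show ?thesis by blast
    qed
  qed
qed


section \<open>Profinite completions\<close>

lemma finite_index_normalD:
  assumes "N \<in> finite_index_normal G"
  shows "N \<lhd> G" "group (G Mod N)" "finite (carrier (G Mod N))"
proof -
  show N: "N \<lhd> G" using assms by (simp add: finite_index_normal_def)
  show "group (G Mod N)" using N by (rule normal.factorgroup_is_group)
  show "finite (carrier (G Mod N))" using assms by (simp add: finite_index_normal_def FactGroup_def)
qed

lemma profinite_completion_carrier_iff:
  "x \<in> carrier (profinite_completion G) \<longleftrightarrow>
    x \<in> (\<Pi>\<^sub>E N\<in>finite_index_normal G. carrier (G Mod N)) \<and>
    (\<forall>N\<in>finite_index_normal G. \<forall>M\<in>finite_index_normal G. N \<subseteq> M \<longrightarrow> x N \<subseteq> x M)"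
  by (simp add: profinite_completion_def)

text \<open>Compatibility is an inclusion of cosets, and both products and setwise inverses of
  cosets are monotone; the inverse in a quotient is the setwise one.\<close>

lemma subgroup_profinite_completion:
  "subgroup (carrier (profinite_completion G)) (product_group (finite_index_normal G) (\<lambda>N. G Mod N))"
  (is "subgroup ?C ?P")
proof
  show "?C \<subseteq> carrier ?P"
    by (rule subsetI) (simp only: profinite_completion_carrier_iff carrier_product_group)
  show "\<one>\<^bsub>?P\<^esub> \<in> ?C"
    using monoid.one_closed[OF group.is_monoid[OF finite_index_normalD(2)]]
    by (auto simp: profinite_completion_carrier_iff)
next
  fix x y assume xy: "x \<in> ?C" "y \<in> ?C"
  have "x N <#>\<^bsub>G\<^esub> y N \<in> carrier (G Mod N)" if N: "N \<in> finite_index_normal G" for N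
    using monoid.m_closed[OF group.is_monoid[OF finite_index_normalD(2)[OF N]], of "x N" "y N"] xy N
    by (auto simp: profinite_completion_carrier_iff PiE_iff)
  moreover have "x N <#>\<^bsub>G\<^esub> y N \<subseteq> x M <#>\<^bsub>G\<^esub> y M"
    if "N \<in> finite_index_normal G" "M \<in> finite_index_normal G" "N \<subseteq> M" for N M
    using xy that by (intro mono_set_mult) (simp_all add: profinite_completion_carrier_iff)
  ultimately show "x \<otimes>\<^bsub>?P\<^esub> y \<in> ?C"
    by (simp add: profinite_completion_carrier_iff)
next
  fix x assume x: "x \<in> ?C"
  then have x': "x \<in> (\<Pi>\<^sub>E N\<in>finite_index_normal G. carrier (G Mod N))"
    by (simp add: profinite_completion_carrier_iff)
  have inv_x: "inv\<^bsub>?P\<^esub> x = (\<lambda>N\<in>finite_index_normal G. inv\<^bsub>G Mod N\<^esub> x N)"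
    using x' finite_index_normalD(2) by (rule inv_product_group)
  have "inv\<^bsub>G Mod N\<^esub> x N \<in> carrier (G Mod N)" "inv\<^bsub>G Mod N\<^esub> x N = set_inv\<^bsub>G\<^esub> (x N)"
    if N: "N \<in> finite_index_normal G" for N
  proof -
    have xN: "x N \<in> carrier (G Mod N)" using x' N by auto
    show "inv\<^bsub>G Mod N\<^esub> x N \<in> carrier (G Mod N)"
      using finite_index_normalD(2)[OF N] xN by (rule group.inv_closed)
    show "inv\<^bsub>G Mod N\<^esub> x N = set_inv\<^bsub>G\<^esub> (x N)"
      using finite_index_normalD(1)[OF N] xN by (rule normal.inv_FactGroup)
  qed
  moreover have "set_inv\<^bsub>G\<^esub> (x N) \<subseteq> set_inv\<^bsub>G\<^esub> (x M)"
    if "N \<in> finite_index_normal G" "M \<in> finite_index_normal G" "N \<subseteq> M" for N M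
  proof -
    have "x N \<subseteq> x M" using x that by (simp add: profinite_completion_carrier_iff)
    then show ?thesis unfolding SET_INV_def by blast
  qed
  ultimately show "inv\<^bsub>?P\<^esub> x \<in> ?C"
    unfolding inv_x by (simp add: profinite_completion_carrier_iff)
qed

lemma group_profinite_completion: "group (profinite_completion G)"
proof -
  have "group (product_group (finite_index_normal G) (\<lambda>N. G Mod N))"
    using finite_index_normalD(2) by (rule product_group)
  then have "group (product_group (finite_index_normal G) (\<lambda>N. G Mod N)
      \<lparr>carrier := carrier (profinite_completion G)\<rparr>)"
    by (rule subgroup.subgroup_is_group[OF subgroup_profinite_completion])
  then show ?thesis by (simp add: profinite_completion_def)
qed

lemma profinite_completion_mult:
  "x \<otimes>\<^bsub>profinite_completion G\<^esub> y = (\<lambda>N\<in>finite_index_normal G. x N <#>\<^bsub>G\<^esub> y N)"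
  by (simp add: profinite_completion_def)

lemma profinite_embedding_closed:
  assumes "g \<in> carrier G"
  shows "profinite_embedding G g \<in> carrier (profinite_completion G)"
proof -
  have "N #>\<^bsub>G\<^esub> g \<subseteq> M #>\<^bsub>G\<^esub> g" if "N \<subseteq> M" for N M
    using that by (auto simp: r_coset_def)
  with assms show ?thesis
    by (auto simp: profinite_completion_carrier_iff profinite_embedding_def carrier_FactGroup)
qed

lemma profinite_embedding_mult:
  assumes "g \<in> carrier G" "h \<in> carrier G"
  shows "profinite_embedding G g \<otimes>\<^bsub>profinite_completion G\<^esub> profinite_embedding G h
    = profinite_embedding G (g \<otimes>\<^bsub>G\<^esub> h)"
proof -
  have "(N #>\<^bsub>G\<^esub> g) <#>\<^bsub>G\<^esub> (N #>\<^bsub>G\<^esub> h) = N #>\<^bsub>G\<^esub> (g \<otimes>\<^bsub>G\<^esub> h)"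
    if "N \<in> finite_index_normal G" for N
    using finite_index_normalD(1)[OF that] assms by (rule normal.rcos_sum)
  then show ?thesis
    unfolding profinite_completion_mult profinite_embedding_def by (intro restrict_ext) simp
qed

lemma profinite_embedding_one:
  assumes "group G"
  shows "profinite_embedding G \<one>\<^bsub>G\<^esub> = \<one>\<^bsub>profinite_completion G\<^esub>"
proof -
  have "N #>\<^bsub>G\<^esub> \<one>\<^bsub>G\<^esub> = N" if "N \<in> finite_index_normal G" for N
    using group.coset_mult_one[OF assms] normal_imp_subgroup[OF finite_index_normalD(1)[OF that]]
      subgroup.subset by blast
  then show ?thesis
    by (simp add: profinite_embedding_def profinite_completion_def cong: restrict_cong)
qed

section \<open>The completion as a compact space with continuous translations\<close>

lemma topspace_profinite_topology [simp]:
  "topspace (profinite_topology G) = carrier (profinite_completion G)"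
proof -
  have "carrier (profinite_completion G) \<subseteq> (\<Pi>\<^sub>E N\<in>finite_index_normal G. carrier (G Mod N))"
    by (rule subsetI) (simp only: profinite_completion_carrier_iff)
  then show ?thesis by (simp add: profinite_topology_def Int_absorb1)
qed

lemma continuous_map_profinite_coordinate:
  assumes "N \<in> finite_index_normal G"
  shows "continuous_map (profinite_topology G) (discrete_topology (carrier (G Mod N))) (\<lambda>x. x N)"
  unfolding profinite_topology_def
  using assms by (intro continuous_map_from_subtopology continuous_map_product_projection)

text \<open>A closed subspace of a product of finite discrete spaces: each compatibility condition
  involves only two coordinates and therefore defines a closed set.\<close>

lemma compact_profinite_topology: "compact_space (profinite_topology G)"
proof -
  define X where "X = product_topology (\<lambda>N. discrete_topology (carrier (G Mod N))) (finite_index_normal G)"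
  have "compact_space X"
    unfolding X_def compact_space_product_topology
    using finite_index_normalD(3) by (auto simp: compact_space_discrete_topology)
  moreover have "closedin X (carrier (profinite_completion G))"
  proof -
    let ?I = "{(N, M). N \<in> finite_index_normal G \<and> M \<in> finite_index_normal G \<and> N \<subseteq> M}"
    have "closedin X {x \<in> topspace X. x N \<subseteq> x M}"
      if N: "N \<in> finite_index_normal G" and M: "M \<in> finite_index_normal G" for N M
    proof -
      have "continuous_map X (prod_topology (discrete_topology (carrier (G Mod N)))
          (discrete_topology (carrier (G Mod M)))) (\<lambda>x. (x N, x M))"
        unfolding X_def using N M
        by (intro continuous_map_pairedI continuous_map_product_projection)
      then have "continuous_map X (discrete_topology (carrier (G Mod N) \<times> carrier (G Mod M))) (\<lambda>x. (x N, x M))"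
        by (simp add: prod_topology_discrete_topology)
      from closedin_continuous_map_preimage[OF this,
          of "{p \<in> carrier (G Mod N) \<times> carrier (G Mod M). fst p \<subseteq> snd p}"]
      have "closedin X {x \<in> topspace X. (x N, x M) \<in> {p \<in> carrier (G Mod N) \<times> carrier (G Mod M). fst p \<subseteq> snd p}}"
        by auto
      moreover have "{x \<in> topspace X. (x N, x M) \<in> {p \<in> carrier (G Mod N) \<times> carrier (G Mod M). fst p \<subseteq> snd p}}
        = {x \<in> topspace X. x N \<subseteq> x M}"
        using N M by (auto simp: X_def)
      ultimately show ?thesis by simp
    qed
    \<comment> \<open>The whole space is inserted so that the intersected family is nonempty for
      every \<open>G\<close>.\<close>
    then have "closedin X (\<Inter>(insert (topspace X) ((\<lambda>(N, M). {x \<in> topspace X. x N \<subseteq> x M}) ` ?I)))"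
      by (intro closedin_Inter) auto
    moreover have "\<Inter>(insert (topspace X) ((\<lambda>(N, M). {x \<in> topspace X. x N \<subseteq> x M}) ` ?I))
      = {x \<in> topspace X. \<forall>N\<in>finite_index_normal G. \<forall>M\<in>finite_index_normal G. N \<subseteq> M \<longrightarrow> x N \<subseteq> x M}"
      by auto
    moreover have "\<dots> = carrier (profinite_completion G)"
      unfolding set_eq_iff profinite_completion_carrier_iff by (simp add: X_def)
    ultimately show ?thesis by simp
  qed
  ultimately show ?thesis
    unfolding profinite_topology_def X_def[symmetric]
    by (intro compact_space_subtopology closedin_compact_space)
qed

lemma continuous_map_profinite_translation:
  assumes "h \<in> carrier (profinite_completion G)"
  shows "continuous_map (profinite_topology G) (profinite_topology G)
    (\<lambda>x. x \<otimes>\<^bsub>profinite_completion G\<^esub> h)"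
proof -
  have closed: "x \<otimes>\<^bsub>profinite_completion G\<^esub> h \<in> carrier (profinite_completion G)"
    if "x \<in> carrier (profinite_completion G)" for x
    using group.is_monoid[OF group_profinite_completion] that assms by (rule monoid.m_closed)
  have "continuous_map (profinite_topology G) (discrete_topology (carrier (G Mod N)))
      (\<lambda>x. (x \<otimes>\<^bsub>profinite_completion G\<^esub> h) N)" if N: "N \<in> finite_index_normal G" for N
  proof -
    have "(\<lambda>c. c <#>\<^bsub>G\<^esub> h N) \<in> carrier (G Mod N) \<rightarrow> carrier (G Mod N)"
      using monoid.m_closed[OF group.is_monoid[OF finite_index_normalD(2)[OF N]], of _ "h N"] assms N
      by (auto simp: profinite_completion_carrier_iff)
    then have "continuous_map (discrete_topology (carrier (G Mod N)))
        (discrete_topology (carrier (G Mod N))) (\<lambda>c. c <#>\<^bsub>G\<^esub> h N)"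
      by simp
    from continuous_map_compose[OF continuous_map_profinite_coordinate[OF N] this] N
    show ?thesis by (simp add: comp_def profinite_completion_mult)
  qed
  moreover have "x \<otimes>\<^bsub>profinite_completion G\<^esub> h \<in> extensional (finite_index_normal G)" for x
    by (simp add: profinite_completion_mult)
  ultimately have "continuous_map (profinite_topology G)
      (product_topology (\<lambda>N. discrete_topology (carrier (G Mod N))) (finite_index_normal G))
      (\<lambda>x. x \<otimes>\<^bsub>profinite_completion G\<^esub> h)"
    by (auto simp: continuous_map_componentwise)
  then have "continuous_map (profinite_topology G)
      (subtopology (product_topology (\<lambda>N. discrete_topology (carrier (G Mod N))) (finite_index_normal G))
        (carrier (profinite_completion G)))
      (\<lambda>x. x \<otimes>\<^bsub>profinite_completion G\<^esub> h)"
    using closed by (intro continuous_map_into_subtopology) auto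
  then show ?thesis by (simp add: profinite_topology_def[symmetric])
qed


section \<open>Haar measure on a compact group\<close>

text \<open>Right translations are the ones through which the torus group moves the profinite
  variable in \<open>invariant_continuous\<close>.\<close>

locale compact_haar =
  fixes K :: "('a, 'b) monoid_scheme" (structure) and T :: "'a topology" and m :: "'a measure"
  assumes group_K: "group K" and topspace_T: "topspace T = carrier K"
    and compact_T: "compact_space T"
    and continuous_translation: "\<And>h. h \<in> carrier K \<Longrightarrow> continuous_map T T (\<lambda>x. x \<otimes> h)"
    and haar: "haar_probability K T m"
begin

interpretation K: group K by (rule group_K)

lemma prob_space_m: "prob_space m"
  using haar by (simp add: haar_probability_def)

lemma sets_m: "sets m = sigma_sets (carrier K) {U. openin T U}"
proof -
  have "sets m = sets (sigma (topspace T) {U. openin T U})"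
    using haar by (simp add: haar_probability_def)
  also have "\<dots> = sigma_sets (topspace T) {U. openin T U}"
    by (intro sets_measure_of) (auto dest: openin_subset)
  finally show ?thesis by (simp add: topspace_T)
qed

lemma space_m: "space m = carrier K"
proof -
  have "sets m = sets (sigma (topspace T) {U. openin T U})"
    using haar by (simp add: haar_probability_def)
  then have "space m = space (sigma (topspace T) {U. openin T U})" by (rule sets_eq_imp_space_eq)
  also have "\<dots> = topspace T" by (intro space_measure_of) (auto dest: openin_subset)
  finally show ?thesis by (simp add: topspace_T)
qed

lemma openin_sets: "openin T U \<Longrightarrow> U \<in> sets m"
  by (simp add: sets_m)

lemma borel_measurable_continuous:
  fixes f :: "'a \<Rightarrow> real"
  assumes "continuous_map T euclideanreal f"
  shows "f \<in> borel_measurable m"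
proof (rule borel_measurableI)
  fix S :: "real set" assume "open S"
  then have "openin T {x \<in> topspace T. f x \<in> S}"
    using assms by (simp add: openin_continuous_map_preimage)
  moreover have "f -` S \<inter> space m = {x \<in> topspace T. f x \<in> S}"
    by (auto simp: space_m topspace_T)
  ultimately show "f -` S \<inter> space m \<in> sets m" by (simp add: openin_sets)
qed

lemma integrable_continuous:
  fixes f :: "'a \<Rightarrow> real"
  assumes "continuous_map T euclideanreal f"
  shows "integrable m f"
proof -
  interpret prob_space m by (rule prob_space_m)
  have "compactin euclideanreal (f ` topspace T)"
    using compact_T assms by (intro image_compactin) (auto simp: compact_space_def)
  then have "bounded (f ` carrier K)"
    by (simp add: topspace_T compact_imp_bounded)
  then obtain B where "\<forall>x\<in>carrier K. norm (f x) \<le> B" by (auto simp: bounded_iff)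
  then show ?thesis
    using borel_measurable_continuous[OF assms]
    by (intro integrable_const_bound[of f B] AE_I2) (auto simp: space_m)
qed

lemma translation_measurable:
  assumes "h \<in> carrier K"
  shows "(\<lambda>x. x \<otimes> h) \<in> measurable m m"
proof (rule measurable_sigma_sets[OF sets_m])
  show "{U. openin T U} \<subseteq> Pow (carrier K)" using openin_subset topspace_T by blast
  show "(\<lambda>x. x \<otimes> h) \<in> space m \<rightarrow> carrier K" using assms by (simp add: space_m)
  fix U assume "U \<in> {U. openin T U}"
  then have "openin T {x \<in> topspace T. x \<otimes> h \<in> U}"
    using continuous_translation[OF assms] by (simp add: openin_continuous_map_preimage)
  moreover have "(\<lambda>x. x \<otimes> h) -` U \<inter> space m = {x \<in> topspace T. x \<otimes> h \<in> U}"
    by (auto simp: space_m topspace_T)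
  ultimately show "(\<lambda>x. x \<otimes> h) -` U \<inter> space m \<in> sets m" by (simp add: openin_sets)
qed

text \<open>\<open>haar_probability\<close> speaks of images of sets, push-forward of measures of
  preimages; inverting the translating element exchanges the two.\<close>

lemma translation_preimage:
  assumes "h \<in> carrier K" "A \<subseteq> carrier K"
  shows "(\<lambda>x. x \<otimes> h) -` A \<inter> carrier K = (\<lambda>x. x \<otimes> inv h) ` A"
proof (intro equalityI subsetI)
  fix x assume "x \<in> (\<lambda>x. x \<otimes> h) -` A \<inter> carrier K"
  then have "x \<otimes> h \<in> A" "x = (x \<otimes> h) \<otimes> inv h"
    using assms by (auto simp: K.m_assoc)
  then show "x \<in> (\<lambda>x. x \<otimes> inv h) ` A" by blast
next
  fix x assume "x \<in> (\<lambda>x. x \<otimes> inv h) ` A"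
  then obtain a where "a \<in> A" "x = a \<otimes> inv h" by blast
  moreover from this assms have "a \<otimes> inv h \<otimes> h = a" by (auto simp: K.m_assoc subset_iff)
  ultimately show "x \<in> (\<lambda>x. x \<otimes> h) -` A \<inter> carrier K" using assms by auto
qed

lemma emeasure_translation:
  assumes "h \<in> carrier K" "A \<in> sets m"
  shows "emeasure m ((\<lambda>x. x \<otimes> h) -` A \<inter> space m) = emeasure m A"
proof -
  have "A \<subseteq> carrier K" using sets.sets_into_space[OF assms(2)] by (simp add: space_m)
  then have "(\<lambda>x. x \<otimes> h) -` A \<inter> space m = (\<lambda>x. x \<otimes> inv h) ` A"
    unfolding space_m using assms(1) by (intro translation_preimage)
  moreover have "emeasure m ((\<lambda>x. x \<otimes> inv h) ` A) = emeasure m A"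
    using haar assms K.inv_closed[OF assms(1)] unfolding haar_probability_def by blast
  ultimately show ?thesis by simp
qed

lemma integral_translation:
  fixes f :: "'a \<Rightarrow> real"
  assumes "h \<in> carrier K" "continuous_map T euclideanreal f"
  shows "(LINT x|m. f (x \<otimes> h)) = (LINT x|m. f x)"
proof -
  have "distr m m (\<lambda>x. x \<otimes> h) = m"
    using translation_measurable[OF assms(1)] emeasure_translation[OF assms(1)]
    by (intro measure_eqI) (simp_all add: emeasure_distr)
  then have "(LINT x|m. f x) = (LINT x|distr m m (\<lambda>x. x \<otimes> h). f x)" by simp
  also have "\<dots> = (LINT x|m. f (x \<otimes> h))"
    using translation_measurable[OF assms(1)] borel_measurable_continuous[OF assms(2)]
    by (rule integral_distr)
  finally show ?thesis ..
qed

text \<open>Translates of a nonempty open set cover the group, and by compactness finitely many do;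
  if the set were null, the whole probability space would be.\<close>

lemma emeasure_open_pos:
  assumes "openin T U" "U \<noteq> {}"
  shows "emeasure m U \<noteq> 0"
proof
  assume 0: "emeasure m U = 0"
  interpret prob_space m by (rule prob_space_m)
  define V where "V = (\<lambda>h. {x \<in> topspace T. x \<otimes> h \<in> U})"
  have V: "V h = (\<lambda>x. x \<otimes> h) -` U \<inter> space m" for h
    by (auto simp: V_def space_m topspace_T)
  have openV: "openin T (V h)" if "h \<in> carrier K" for h
    unfolding V_def using continuous_translation[OF that] assms(1) by (simp add: openin_continuous_map_preimage)
  obtain x0 where x0: "x0 \<in> U" "x0 \<in> carrier K" using assms openin_subset topspace_T by fastforce
  have "carrier K \<subseteq> \<Union> (V ` carrier K)"
  proof
    fix y assume y: "y \<in> carrier K"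
    \<comment> \<open>Translation by \<open>inv y \<otimes> x0\<close> moves \<open>y\<close> to the
      point \<open>x0\<close> of \<open>U\<close>.\<close>
    then have "y \<otimes> (inv y \<otimes> x0) = x0" using x0 by (simp add: K.m_assoc[symmetric])
    then have "y \<in> V (inv y \<otimes> x0)" using y x0 by (simp add: V_def topspace_T)
    then show "y \<in> \<Union> (V ` carrier K)" using y x0 by (intro UN_I[of "inv y \<otimes> x0"]) simp_all
  qed
  then obtain \<F> where F: "finite \<F>" "\<F> \<subseteq> V ` carrier K" "carrier K \<subseteq> \<Union> \<F>"
    using compact_T[unfolded compact_space_alt topspace_T, rule_format, of "V ` carrier K"] openV
    by auto
  have "emeasure m W = 0" "W \<in> sets m" if W: "W \<in> \<F>" for W
  proof -
    obtain h where h: "h \<in> carrier K" "W = V h" using F(2) W by blast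
    then show "emeasure m W = 0"
      using emeasure_translation[OF h(1) openin_sets[OF assms(1)]] 0 by (simp add: V)
    show "W \<in> sets m" using openV[OF h(1)] openin_sets h(2) by simp
  qed
  then have "(\<Union>W\<in>\<F>. W) \<in> null_sets m"
    using F(1) by (intro null_sets_UN') (auto simp: null_sets_def countable_finite)
  then have "emeasure m (\<Union> \<F>) = 0" by auto
  moreover have "\<Union> \<F> = space m"
    using F V by (auto simp: space_m)
  ultimately show False using emeasure_space_1 by simp
qed

text \<open>Continuity upgrades vanishing almost everywhere to vanishing everywhere: the set where
  \<open>f\<close> is positive is open and null, hence empty.\<close>

lemma integral_nonneg_eq_0:
  fixes f :: "'a \<Rightarrow> real"
  assumes "continuous_map T euclideanreal f" "\<And>x. x \<in> carrier K \<Longrightarrow> 0 \<le> f x"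
    and "(LINT x|m. f x) = 0" "x \<in> carrier K"
  shows "f x = 0"
proof (rule ccontr)
  assume "f x \<noteq> 0"
  then have "f x > 0" using assms(2,4) by force
  have "AE x in m. f x = 0"
    using integral_nonneg_eq_0_iff_AE[OF integrable_continuous[OF assms(1)]] assms(3)
      AE_I2[of m "\<lambda>x. 0 \<le> f x"] assms(2) by (simp add: space_m)
  define U where "U = {x \<in> topspace T. f x \<in> {0<..}}"
  have U: "openin T U" unfolding U_def using assms(1) by (rule openin_continuous_map_preimage) simp
  have "U \<noteq> {}" using \<open>f x > 0\<close> assms(4) by (auto simp: U_def topspace_T)
  from \<open>AE x in m. f x = 0\<close> have "AE x in m. x \<notin> U" by eventually_elim (simp add: U_def)
  then have "U \<in> null_sets m" using openin_sets[OF U] by (simp add: AE_iff_null_sets)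
  then show False using emeasure_open_pos[OF U \<open>U \<noteq> {}\<close>] by auto
qed

end


section \<open>Invariant continuous functions\<close>

abbreviation ghat_mult (infixl "\<star>" 70) where "s \<star> t \<equiv> s \<otimes>\<^bsub>Ghat\<^esub> t"
abbreviation emb where "emb \<equiv> profinite_embedding torus_group"

lemma ghat_mult_closed: "s \<in> carrier Ghat \<Longrightarrow> t \<in> carrier Ghat \<Longrightarrow> s \<star> t \<in> carrier Ghat"
  using group.is_monoid[OF group_profinite_completion] by (rule monoid.m_closed)

lemma emb_closed: "g \<in> carrier torus_group \<Longrightarrow> emb g \<in> carrier Ghat"
  by (rule profinite_embedding_closed)

lemma emb_inv_closed: "g \<in> carrier torus_group \<Longrightarrow> emb (inv\<^bsub>torus_group\<^esub> g) \<in> carrier Ghat"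
  by (simp add: emb_closed group.inv_closed[OF group_torus_group])

lemma invariant_continuousD:
  assumes "x \<in> invariant_continuous" "t \<in> carrier Ghat"
  shows "uniform_limit farey_edges x (x t) (atin Ghat_topology t)"
    and "g \<in> carrier torus_group \<Longrightarrow> e \<in> farey_edges \<Longrightarrow> x (t \<star> emb (inv\<^bsub>torus_group\<^esub> g)) (g ` e) = x t e"
  using assms by (auto simp: invariant_continuous_def)

text \<open>The invariance condition solved for the translated edge, which is exchanged for a shift
  of \<open>t\<close>.\<close>

lemma invariant_continuous_orbit:
  assumes "x \<in> invariant_continuous" "t \<in> carrier Ghat" "g \<in> carrier torus_group" "e \<in> farey_edges"
  shows "x t (g ` e) = x (t \<star> emb g) e"
proof -
  interpret C: group Ghat by (rule group_profinite_completion)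
  interpret G: group torus_group by (rule group_torus_group)
  have "t \<star> emb g \<star> emb (inv\<^bsub>torus_group\<^esub> g) = t \<star> (emb g \<star> emb (inv\<^bsub>torus_group\<^esub> g))"
    using assms by (intro C.m_assoc emb_closed emb_inv_closed)
  also have "emb g \<star> emb (inv\<^bsub>torus_group\<^esub> g) = \<one>\<^bsub>Ghat\<^esub>"
    using assms(3) by (simp add: profinite_embedding_mult profinite_embedding_one[OF group_torus_group])
  finally have "t \<star> emb g \<star> emb (inv\<^bsub>torus_group\<^esub> g) = t" using assms(2) by simp
  with invariant_continuousD(2)[OF assms(1) ghat_mult_closed[OF assms(2) emb_closed[OF assms(3)]] assms(3,4)]
  show ?thesis by simp
qed

lemma invariant_continuous_continuous_map:
  assumes "x \<in> invariant_continuous" "e \<in> farey_edges"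
  shows "continuous_map Ghat_topology euclideanreal (\<lambda>t. x t e)"
  unfolding continuous_map_atin limitin_canonical_iff
  using tendsto_uniform_limitI[OF invariant_continuousD(1)[OF assms(1)] assms(2)] by simp

lemma base_edges_farey: "{1, -1} \<in> farey_edges" "{-1, -\<i>} \<in> farey_edges" "{-\<i>, 1} \<in> farey_edges"
  "{1, \<i>} \<in> farey_edges" "{\<i>, -1} \<in> farey_edges"
  by (rule farey_edgeI[OF lower_triangle_farey] farey_edgeI[OF upper_triangle_farey];
      simp add: complex_eq_iff)+

lemma compactin_image_ghat:
  assumes "continuous_map Ghat_topology euclideanreal f"
  shows "compact (f ` carrier Ghat)"
proof -
  have "compactin Ghat_topology (carrier Ghat)"
    using compact_profinite_topology[of torus_group] by (simp add: compact_space_def)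
  from image_compactin[OF this assms] show ?thesis by simp
qed

text \<open>At each of the three representative edges there is a continuous function on a compact
  group; the orbit relation carries their common bound to every edge.\<close>

lemma invariant_continuous_bounded:
  assumes "x \<in> invariant_continuous"
  obtains B where "\<And>t e. t \<in> carrier Ghat \<Longrightarrow> e \<in> farey_edges \<Longrightarrow> \<bar>x t e\<bar> \<le> B"
proof -
  have "bounded ((\<lambda>t. x t e) ` carrier Ghat)" if "e \<in> farey_edges" for e
    using that assms by (intro compact_imp_bounded compactin_image_ghat invariant_continuous_continuous_map)
  then have "bounded (\<Union>e\<in>{{1, -1}, {-1, -\<i>}, {-\<i>, 1}}. (\<lambda>t. x t e) ` carrier Ghat)"
    using base_edges_farey by (intro bounded_UN) auto
  then obtain B where B: "\<And>t e. e \<in> {{1, -1}, {-1, -\<i>}, {-\<i>, 1}} \<Longrightarrow> t \<in> carrier Ghat \<Longrightarrow> \<bar>x t e\<bar> \<le> B"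
    unfolding bounded_iff by fastforce
  have "\<bar>x t e\<bar> \<le> B" if t: "t \<in> carrier Ghat" and e: "e \<in> farey_edges" for t e
  proof -
    obtain g e0 where g: "g \<in> carrier torus_group" "e0 \<in> {{1, -1}, {-1, -\<i>}, {-\<i>, 1}}" "e = g ` e0"
      using e by (rule farey_edge_orbit)
    then have "e0 \<in> farey_edges" using base_edges_farey by auto
    with g t assms have "x t e = x (t \<star> emb g) e0" by (simp add: invariant_continuous_orbit)
    with B[OF g(2) ghat_mult_closed[OF t emb_closed[OF g(1)]]] show ?thesis by simp
  qed
  with that show thesis by blast
qed

text \<open>Uniformity over all edges is what makes division by \<open>l\<close> compatible with the
  supremum topology.\<close>

lemma decorated_teichmueller_lower_bound:
  assumes "l \<in> decorated_teichmueller"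
  obtains b where "b > 0" "\<And>t e. t \<in> carrier Ghat \<Longrightarrow> e \<in> farey_edges \<Longrightarrow> b \<le> l t e"
proof -
  have l: "l \<in> invariant_continuous" "\<And>t e. t \<in> carrier Ghat \<Longrightarrow> e \<in> farey_edges \<Longrightarrow> l t e > 0"
    using assms by (auto simp: decorated_teichmueller_def)
  have "\<exists>b>0. \<forall>t\<in>carrier Ghat. b \<le> l t e" if e: "e \<in> farey_edges" for e
  proof -
    have "(\<lambda>t. l t e) ` carrier Ghat \<noteq> {}"
      using group.is_monoid[OF group_profinite_completion, THEN monoid.one_closed] by blast
    with compact_attains_inf[OF compactin_image_ghat[OF invariant_continuous_continuous_map[OF l(1) e]]]
    obtain s where "s \<in> carrier Ghat" "\<forall>t\<in>carrier Ghat. l s e \<le> l t e" by auto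
    with l(2) e show ?thesis by blast
  qed
  then obtain b where b: "\<And>e. e \<in> farey_edges \<Longrightarrow> b e > 0"
    "\<And>e t. e \<in> farey_edges \<Longrightarrow> t \<in> carrier Ghat \<Longrightarrow> b e \<le> l t e" by metis
  define b0 where "b0 = min (b {1, -1}) (min (b {-1, -\<i>}) (b {-\<i>, 1}))"
  have "b0 > 0" using b(1) base_edges_farey by (simp add: b0_def)
  moreover have "b0 \<le> l t e" if t: "t \<in> carrier Ghat" and e: "e \<in> farey_edges" for t e
  proof -
    obtain g e0 where g: "g \<in> carrier torus_group" "e0 \<in> {{1, -1}, {-1, -\<i>}, {-\<i>, 1}}" "e = g ` e0"
      using e by (rule farey_edge_orbit)
    then have e0: "e0 \<in> farey_edges" using base_edges_farey by auto
    with g t l(1) have "l t e = l (t \<star> emb g) e0" by (simp add: invariant_continuous_orbit)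
    moreover have "b0 \<le> b e0" using g(2) by (auto simp: b0_def)
    moreover have "b e0 \<le> l (t \<star> emb g) e0" using b(2)[OF e0 ghat_mult_closed[OF t emb_closed[OF g(1)]]] .
    ultimately show ?thesis by linarith
  qed
  ultimately show thesis using that by blast
qed

text \<open>Places logarithmic derivatives in the space of tangent vectors, so that shears and the
  form can be applied to them directly.\<close>

lemma invariant_continuous_divide:
  assumes "v \<in> invariant_continuous" "l \<in> decorated_teichmueller"
  shows "(\<lambda>t e. v t e / l t e) \<in> invariant_continuous"
proof -
  have l: "l \<in> invariant_continuous" using assms(2) by (simp add: decorated_teichmueller_def)
  obtain B where B: "\<And>t e. t \<in> carrier Ghat \<Longrightarrow> e \<in> farey_edges \<Longrightarrow> \<bar>v t e\<bar> \<le> B"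
    using assms(1) by (rule invariant_continuous_bounded) blast
  obtain b where b: "b > 0" "\<And>t e. t \<in> carrier Ghat \<Longrightarrow> e \<in> farey_edges \<Longrightarrow> b \<le> l t e"
    using assms(2) by (rule decorated_teichmueller_lower_bound) blast
  have "uniform_limit farey_edges (\<lambda>t e. v t e / l t e) (\<lambda>e. v t e / l t e) (atin Ghat_topology t)"
    if t: "t \<in> carrier Ghat" for t
  proof (rule uniform_lim_divide)
    show "uniform_limit farey_edges v (v t) (atin Ghat_topology t)"
      "uniform_limit farey_edges l (l t) (atin Ghat_topology t)"
      using assms(1) l t by (simp_all add: invariant_continuousD)
    show "bounded (v t ` farey_edges)"
      unfolding bounded_iff using B[OF t] by auto
    show "b \<le> norm (l t e)" if "e \<in> farey_edges" for e
      using b(2)[OF t that] by simp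
  qed fact
  then show ?thesis
    using invariant_continuousD(2)[OF assms(1)] invariant_continuousD(2)[OF l]
    by (auto simp: invariant_continuous_def)
qed


section \<open>Shear coordinates\<close>

definition quad_shear :: "(edge \<Rightarrow> real) \<Rightarrow> complex \<Rightarrow> complex \<Rightarrow> real" where
  "quad_shear f v w = f {ideal_point v, ideal_point (v + w)} + f {ideal_point w, ideal_point (v - w)}
     - f {ideal_point (v + w), ideal_point w} - f {ideal_point (v - w), ideal_point v}"

text \<open>The condition \<open>wedge v w = 1\<close> makes the vertices \<open>v, v + w, w, v - w\<close> of the quadrilateral
  counterclockwise; with the other orientation the shear would change its sign.\<close>

definition shear :: "(edge \<Rightarrow> real) \<Rightarrow> edge \<Rightarrow> real" where
  "shear f e = (THE s. \<exists>v w. unimodular v w \<and> e = {ideal_point v, ideal_point w} \<and> s = quad_shear f v w)"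

text \<open>Bases of one edge differ by a common sign, which changes no ideal point, and by the
  quarter turn from \<open>(v, w)\<close> to \<open>(w, - v)\<close>. The latter gives the
  quadrilateral a half turn: opposite sides are exchanged and the alternating sum stays the
  same.\<close>

lemma quad_shear_unique:
  assumes "unimodular v w" "unimodular v' w'"
    and "{ideal_point v, ideal_point w} = {ideal_point v', ideal_point w'}"
  shows "quad_shear f v' w' = quad_shear f v w"
proof -
  have minus: "quad_shear f (- v) (- w) = quad_shear f v w" for v w
  proof -
    have "- v + - w = - (v + w)" "- v - - w = - (v - w)" by simp_all
    then show ?thesis by (simp only: quad_shear_def ideal_point_minus)
  qed
  have swap: "quad_shear f w (- v) = quad_shear f v w"
  proof -
    have "w + - v = - (v - w)" "w - - v = v + w" by simp_all
    then show ?thesis by (simp only: quad_shear_def ideal_point_minus insert_commute)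
  qed
  from assms(3) consider "ideal_point v' = ideal_point v" "ideal_point w' = ideal_point w"
    | "ideal_point v' = ideal_point w" "ideal_point w' = ideal_point (- v)"
    by (auto simp: doubleton_eq_iff)
  then show ?thesis
  proof cases
    case 1
    from unimodular_same_ideal_points[OF assms(1,2) this] show ?thesis by (auto simp: minus)
  next
    case 2
    from unimodular_same_ideal_points[OF unimodular_transform(1)[OF assms(1)] assms(2) this]
    show ?thesis using minus[of w "- v"] by (auto simp: swap)
  qed
qed

lemma shear_eq:
  assumes "unimodular v w"
  shows "shear f {ideal_point v, ideal_point w} = quad_shear f v w"
  unfolding shear_def using assms by (intro the_equality) (auto dest: quad_shear_unique)

lemma quad_shear_edges:
  assumes "unimodular v w" "{ideal_point v, ideal_point w} \<in> farey_edges"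
  shows "{ideal_point v, ideal_point (v + w)} \<in> farey_edges" "{ideal_point w, ideal_point (v - w)} \<in> farey_edges"
    "{ideal_point (v + w), ideal_point w} \<in> farey_edges" "{ideal_point (v - w), ideal_point v} \<in> farey_edges"
proof -
  have T: "triangle_sum v w \<in> farey_triangles" "triangle_diff v w \<in> farey_triangles"
    using assms by (simp_all add: farey_edge_iff)
  have "unimodular v (- (v - w))" using unimodular_transform(6)[OF assms(1)] by simp
  note ne = unimodularD(3)[OF this] unimodularD(3)[OF unimodular_transform(3)[OF assms(1)]]
    unimodularD(3)[OF unimodular_transform(4)[OF assms(1)]] unimodularD(3)[OF unimodular_transform(5)[OF assms(1)]]
  show "{ideal_point v, ideal_point (v + w)} \<in> farey_edges" "{ideal_point (v + w), ideal_point w} \<in> farey_edges"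
    using ne by (intro farey_edgeI[OF T(1)]; simp)+
  show "{ideal_point w, ideal_point (v - w)} \<in> farey_edges" "{ideal_point (v - w), ideal_point v} \<in> farey_edges"
    using ne ideal_point_diff_commute[of v w] by (intro farey_edgeI[OF T(2)]; auto)+
qed

text \<open>Four edges enter each shear, so uniform closeness within a quarter of
  \<open>\<epsilon>\<close> suffices. Invariance is the application of
  \<open>PSL2Z_unimodular\<close>: group elements carry the quadrilateral of an edge to that of its
  image without a change of sign.\<close>

lemma invariant_continuous_shear:
  assumes "x \<in> invariant_continuous"
  shows "(\<lambda>t. shear (x t)) \<in> invariant_continuous"
proof -
  have "uniform_limit farey_edges (\<lambda>t. shear (x t)) (shear (x t)) (atin Ghat_topology t)"
    if t: "t \<in> carrier Ghat" for t
  proof (rule uniform_limitI)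
    fix \<epsilon> :: real assume "\<epsilon> > 0"
    then have "\<forall>\<^sub>F s in atin Ghat_topology t. \<forall>e\<in>farey_edges. dist (x s e) (x t e) < \<epsilon> / 4"
      using invariant_continuousD(1)[OF assms t] by (intro uniform_limitD) simp_all
    then show "\<forall>\<^sub>F s in atin Ghat_topology t. \<forall>e\<in>farey_edges. dist (shear (x s) e) (shear (x t) e) < \<epsilon>"
    proof eventually_elim
      case (elim s)
      show ?case
      proof
        fix e assume e: "e \<in> farey_edges"
        then obtain v w where vw: "unimodular v w" "e = {ideal_point v, ideal_point w}"
          by (rule farey_edge_coordinates)
        note E = quad_shear_edges[OF vw(1) e[unfolded vw(2)]]
        from E[THEN elim[rule_format]] show "dist (shear (x s) e) (shear (x t) e) < \<epsilon>"
          unfolding vw(2) shear_eq[OF vw(1)] quad_shear_def dist_real_def by linarith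
      qed
    qed
  qed
  moreover have "shear (x (t \<star> emb (inv\<^bsub>torus_group\<^esub> g))) (g ` e) = shear (x t) e"
    if g: "g \<in> carrier torus_group" and t: "t \<in> carrier Ghat" and e: "e \<in> farey_edges" for g t e
  proof -
    obtain v w where vw: "unimodular v w" "e = {ideal_point v, ideal_point w}"
      using e by (rule farey_edge_coordinates)
    obtain v' w' where vw': "unimodular v' w'" "g (ideal_point v) = ideal_point v'"
      "g (ideal_point w) = ideal_point w'" "g (ideal_point (v + w)) = ideal_point (v' + w')"
      "g (ideal_point (v - w)) = ideal_point (v' - w')"
      using torus_group_subset[OF g] vw(1) e[unfolded vw(2)] by (rule PSL2Z_unimodular)
    note E = quad_shear_edges[OF vw(1) e[unfolded vw(2)]]
    note I = E[THEN invariant_continuousD(2)[OF assms t g]]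
    have "g ` e = {ideal_point v', ideal_point w'}" using vw vw' by simp
    then have "shear (x (t \<star> emb (inv\<^bsub>torus_group\<^esub> g))) (g ` e)
        = quad_shear (x (t \<star> emb (inv\<^bsub>torus_group\<^esub> g))) v' w'"
      using vw' by (simp add: shear_eq)
    also have "\<dots> = quad_shear (x t) v w"
      using I unfolding image_insert image_empty vw' quad_shear_def by simp
    also have "\<dots> = shear (x t) e" using vw by (simp add: shear_eq)
    finally show ?thesis .
  qed
  ultimately show ?thesis by (simp add: invariant_continuous_def)
qed


section \<open>Cross ratios and shears\<close>

text \<open>\<open>farey_quadrilaterals\<close> admits both cyclic directions, the shear only the
  counterclockwise one; hence the sign.\<close>

lemma farey_quadrilateral_shear:
  assumes "(a, b, c, d) \<in> farey_quadrilaterals"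
  obtains v w where "unimodular v w" "{ideal_point v, ideal_point w} \<in> farey_edges"
    "\<And>f. f a + f c - f b - f d = quad_shear f v w \<or> f a + f c - f b - f d = - quad_shear f v w"
    "{a, b, c, d} \<subseteq> farey_edges"
proof -
  obtain p q r s where q: "a = {p, q}" "b = {q, r}" "c = {r, s}" "d = {s, p}"
    "{p, q, r} \<in> farey_triangles" "{p, r, s} \<in> farey_triangles" "q \<noteq> s"
    using assms unfolding farey_quadrilaterals_def by blast
  have card3: "card T = 3" if T: "T \<in> farey_triangles" for T
  proof -
    obtain v w where vw: "unimodular v w" "T = triangle_sum v w"
      using T by (rule farey_triangle_coordinates)
    have "ideal_point v \<noteq> ideal_point w" "ideal_point v \<noteq> ideal_point (v + w)" "ideal_point (v + w) \<noteq> ideal_point w"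
      using unimodularD(3)[OF vw(1)] unimodularD(3)[OF unimodular_transform(3)[OF vw(1)]]
        unimodularD(3)[OF unimodular_transform(4)[OF vw(1)]] by auto
    then show ?thesis by (simp add: vw(2))
  qed
  have dist: "p \<noteq> r" "p \<noteq> q" "q \<noteq> r" "p \<noteq> s" "s \<noteq> r"
    using card3[OF q(5)] card3[OF q(6)] by (auto simp: card_insert_if split: if_splits)
  obtain v w where vw: "unimodular v w" "p = ideal_point v" "r = ideal_point w"
    by (rule farey_triangle_side[OF q(5), of p r]) (simp_all add: dist)
  have E: "{ideal_point v, ideal_point w} \<in> farey_edges"
    using farey_edgeI[OF q(5), of p r] dist vw by simp
  \<comment> \<open>Only two triangles contain the diagonal, so the distinct vertices
    \<open>q\<close> and \<open>s\<close> must be the two candidates in some order.\<close>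
  have third: "z = ideal_point (v + w) \<or> z = ideal_point (v - w)"
    if z: "{p, r, z} \<in> farey_triangles" "z \<noteq> p" "z \<noteq> r" for z
  proof -
    obtain v' w' where 1: "unimodular v' w'" "p = ideal_point v'" "r = ideal_point w'"
      and T: "{p, r, z} = triangle_sum v' w' \<or> {p, r, z} = triangle_diff v' w'"
      using farey_triangle_side[OF z(1), of p r] dist(1) by (metis insertI1 insertI2)
    have "v' = v \<and> w' = w \<or> v' = - v \<and> w' = - w"
      using unimodular_same_ideal_points[OF vw(1) 1(1)] vw 1 by simp
    moreover have "ideal_point (- v + - w) = ideal_point (v + w)"
      "ideal_point (- v - - w) = ideal_point (v - w)"
      using ideal_point_minus[of "v + w"] ideal_point_minus[of "v - w"] by simp_all
    moreover have "z = ideal_point (v' + w') \<or> z = ideal_point (v' - w')"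
      using T z(2,3) 1(2,3) by blast
    ultimately show ?thesis by (elim disjE conjE) simp_all
  qed
  have "{p, r, q} \<in> farey_triangles" using q(5) by (simp add: insert_commute)
  from third[OF this] third[OF q(6)] dist q(7)
  have qs: "q = ideal_point (v + w) \<and> s = ideal_point (v - w) \<or> q = ideal_point (v - w) \<and> s = ideal_point (v + w)"
    by blast
  show thesis
  proof (rule that[OF vw(1) E])
    show "f a + f c - f b - f d = quad_shear f v w \<or> f a + f c - f b - f d = - quad_shear f v w" for f
      using qs unfolding q quad_shear_def vw(2,3)[symmetric] by (auto simp: insert_commute)
    show "{a, b, c, d} \<subseteq> farey_edges"
      using farey_edgeI[OF q(5)] farey_edgeI[OF q(6)] dist unfolding q by auto
  qed
qed

lemma quad_shear_quadrilateral:
  assumes "unimodular v w" "{ideal_point v, ideal_point w} \<in> farey_edges"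
  shows "({ideal_point v, ideal_point (v + w)}, {ideal_point (v + w), ideal_point w},
    {ideal_point w, ideal_point (v - w)}, {ideal_point (v - w), ideal_point v}) \<in> farey_quadrilaterals"
proof -
  have "{ideal_point v, ideal_point (v + w), ideal_point w} \<in> farey_triangles"
    "triangle_diff v w \<in> farey_triangles"
    using assms by (simp_all add: farey_edge_iff insert_commute)
  moreover have "wedge (v + w) (v - w) = -2"
    using assms(1) by (simp add: unimodular_def wedge_eq algebra_simps)
  then have "ideal_point (v + w) \<noteq> ideal_point (v - w)"
    using wedge_nonzeroD[of "v + w" "v - w"] ideal_point_eq_iff[of "v + w" "v - w"] by simp
  ultimately show ?thesis unfolding farey_quadrilaterals_def by blast
qed

text \<open>Logarithmic differentiation of the cross ratio; positivity of the lambda lengths makes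
  it legitimate.\<close>

lemma d_teichmueller_proj_eq:
  assumes "l \<in> decorated_teichmueller"
  shows "d_teichmueller_proj l u (t, a, b, c, d) =
    (if t \<in> carrier Ghat \<and> (a, b, c, d) \<in> farey_quadrilaterals
     then teichmueller_proj l (t, a, b, c, d) * (u t a / l t a + u t c / l t c - u t b / l t b - u t d / l t d)
     else 0)"
proof (cases "t \<in> carrier Ghat \<and> (a, b, c, d) \<in> farey_quadrilaterals")
  case True
  then have "{a, b, c, d} \<subseteq> farey_edges" using farey_quadrilateral_shear by metis
  then have pos: "l t a > 0" "l t b > 0" "l t c > 0" "l t d > 0"
    using assms True by (auto simp: decorated_teichmueller_def)
  have "((\<lambda>s. (l t a + s * u t a) * (l t c + s * u t c) / ((l t b + s * u t b) * (l t d + s * u t d)))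
    has_real_derivative (l t a * l t c) / (l t b * l t d)
       * (u t a / l t a + u t c / l t c - u t b / l t b - u t d / l t d)) (at 0)"
    using pos by (auto intro!: derivative_eq_intros simp: field_simps)
  from DERIV_imp_deriv[OF this] show ?thesis
    using True by (simp add: d_teichmueller_proj_def teichmueller_proj_def)
next
  case False
  then show ?thesis by (auto simp: d_teichmueller_proj_def teichmueller_proj_def)
qed

lemma teichmueller_proj_pos:
  assumes "l \<in> decorated_teichmueller" "t \<in> carrier Ghat" "(a, b, c, d) \<in> farey_quadrilaterals"
  shows "teichmueller_proj l (t, a, b, c, d) > 0"
proof -
  have "{a, b, c, d} \<subseteq> farey_edges" using farey_quadrilateral_shear assms(3) by metis
  then show ?thesis
    using assms by (auto simp: decorated_teichmueller_def teichmueller_proj_def)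
qed

text \<open>The derivatives are the shears times the common cross ratio, which is positive and
  cancels.\<close>

lemma shear_eq_if_d_teichmueller_proj_eq:
  assumes l: "l1 \<in> decorated_teichmueller" "l2 \<in> decorated_teichmueller"
    and eq: "teichmueller_proj l1 = teichmueller_proj l2" "d_teichmueller_proj l1 u1 = d_teichmueller_proj l2 u2"
    and t: "t \<in> carrier Ghat" and e: "e \<in> farey_edges"
  shows "shear (\<lambda>e. u1 t e / l1 t e) e = shear (\<lambda>e. u2 t e / l2 t e) e"
proof -
  obtain v w where vw: "unimodular v w" "e = {ideal_point v, ideal_point w}"
    using e by (rule farey_edge_coordinates)
  note q = quad_shear_quadrilateral[OF vw(1) e[unfolded vw(2)]]
  from fun_cong[OF eq(2), of "(t, {ideal_point v, ideal_point (v + w)}, {ideal_point (v + w), ideal_point w},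
    {ideal_point w, ideal_point (v - w)}, {ideal_point (v - w), ideal_point v})"]
    teichmueller_proj_pos[OF l(2) t q] t q
  show ?thesis
    unfolding d_teichmueller_proj_eq[OF l(1)] d_teichmueller_proj_eq[OF l(2)] eq(1) vw(2) shear_eq[OF vw(1)]
    by (simp add: quad_shear_def)
qed

lemma d_teichmueller_proj_eq_0:
  assumes l: "l \<in> decorated_teichmueller"
    and "\<And>t e. t \<in> carrier Ghat \<Longrightarrow> e \<in> farey_edges \<Longrightarrow> shear (\<lambda>e. v t e / l t e) e = 0"
  shows "d_teichmueller_proj l v = (\<lambda>_. 0)"
proof
  fix z :: "ghat \<times> edge \<times> edge \<times> edge \<times> edge"
  obtain t a b c d where z: "z = (t, a, b, c, d)" by (cases z) auto
  show "d_teichmueller_proj l v z = 0"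
  proof (cases "t \<in> carrier Ghat \<and> (a, b, c, d) \<in> farey_quadrilaterals")
    case True
    then obtain p q where pq: "unimodular p q" "{ideal_point p, ideal_point q} \<in> farey_edges"
      "\<And>f. f a + f c - f b - f d = quad_shear f p q \<or> f a + f c - f b - f d = - quad_shear f p q"
      using farey_quadrilateral_shear by metis
    have "quad_shear (\<lambda>e. v t e / l t e) p q = 0"
      using assms(2)[OF _ pq(2)] True by (simp add: shear_eq[OF pq(1)])
    then show ?thesis
      using pq(3)[of "\<lambda>e. v t e / l t e"] unfolding z d_teichmueller_proj_eq[OF l] by auto
  next
    case False
    show ?thesis by (simp only: z d_teichmueller_proj_eq[OF l] if_not_P[OF False])
  qed
qed


section \<open>The Weil-Petersson form in shear coordinates\<close>

lemma compact_haar_ghat: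
  "haar_probability Ghat Ghat_topology m \<Longrightarrow> compact_haar Ghat Ghat_topology m"
  by (intro compact_haar.intro group_profinite_completion topspace_profinite_topology
      compact_profinite_topology continuous_map_profinite_translation)

text \<open>The generators move the triangles beyond the two lower sides onto the upper triangle.
  Read backwards, this transports the terms of the upper triangle to the lower sides.\<close>

lemma base_edge_images:
  "torus_gen_a ` {-1, -\<i>} = {1, \<i>}" "torus_gen_a ` {-\<i>, ideal_point (1 - 2 * \<i>)} = {1, -1}"
  "torus_gen_a ` {-1, ideal_point (1 - 2 * \<i>)} = {\<i>, -1}"
  "torus_gen_b ` {-\<i>, 1} = {\<i>, -1}" "torus_gen_b ` {1, ideal_point (2 - \<i>)} = {1, \<i>}"
  "torus_gen_b ` {-\<i>, ideal_point (2 - \<i>)} = {1, -1}"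
  by (auto simp: torus_gen_a_values torus_gen_b_values)

lemma base_edges_distinct: "{1, -1} \<noteq> {-1, -\<i>}" "{1, -1} \<noteq> {-\<i>, 1}" "{-1, -\<i>} \<noteq> {-\<i>, 1}"
  by (simp_all add: doubleton_eq_iff complex_eq_iff)

lemma base_edge_shears:
  "shear f {1, -1} = f {1, \<i>} + f {-1, -\<i>} - f {\<i>, -1} - f {-\<i>, 1}"
  "shear f {-1, -\<i>} = f {-\<i>, 1} + f {-1, ideal_point (1 - 2 * \<i>)} - f {1, -1}
     - f {-\<i>, ideal_point (1 - 2 * \<i>)}"
  "shear f {-\<i>, 1} = f {-\<i>, ideal_point (2 - \<i>)} + f {1, -1} - f {1, ideal_point (2 - \<i>)}
     - f {-1, -\<i>}"
proof -
  have m: "ideal_point (- \<i>) = -1" by simp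
  have s: "1 - \<i> + \<i> = 1" "1 - \<i> - \<i> = 1 - 2 * \<i>" "1 - \<i> + 1 = 2 - \<i>" "1 - \<i> - 1 = - \<i>"
    by simp_all
  note S = shear_eq[OF unimodular_simps(1), of f] shear_eq[OF unimodular_simps(3), of f]
    shear_eq[OF unimodular_simps(5), of f]
  note S' = S[unfolded quad_shear_def s, unfolded ideal_point_simps m]
  show "shear f {1, -1} = f {1, \<i>} + f {-1, -\<i>} - f {\<i>, -1} - f {-\<i>, 1}"
    "shear f {-1, -\<i>} = f {-\<i>, 1} + f {-1, ideal_point (1 - 2 * \<i>)} - f {1, -1}
     - f {-\<i>, ideal_point (1 - 2 * \<i>)}"
    "shear f {-\<i>, 1} = f {-\<i>, ideal_point (2 - \<i>)} + f {1, -1} - f {1, ideal_point (2 - \<i>)}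
     - f {-1, -\<i>}"
    using S' by (simp_all add: insert_commute)
qed

lemma base_edge_neighbours_farey:
  "{-\<i>, ideal_point (1 - 2 * \<i>)} \<in> farey_edges" "{-1, ideal_point (1 - 2 * \<i>)} \<in> farey_edges"
  "{1, ideal_point (2 - \<i>)} \<in> farey_edges" "{-\<i>, ideal_point (2 - \<i>)} \<in> farey_edges"
proof -
  have s: "1 - \<i> + \<i> = 1" "1 - \<i> - \<i> = 1 - 2 * \<i>" "1 - \<i> + 1 = 2 - \<i>" "1 - \<i> - 1 = - \<i>"
    by simp_all
  note E = quad_shear_edges[OF unimodular_simps(3), unfolded s, unfolded ideal_point_simps]
    quad_shear_edges[OF unimodular_simps(5), unfolded s, unfolded ideal_point_simps]
  have "{-\<i>, -1} \<in> farey_edges" using base_edges_farey(2) by (simp add: insert_commute)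
  with E base_edges_farey(3) show
    "{-\<i>, ideal_point (1 - 2 * \<i>)} \<in> farey_edges" "{-1, ideal_point (1 - 2 * \<i>)} \<in> farey_edges"
    "{1, ideal_point (2 - \<i>)} \<in> farey_edges" "{-\<i>, ideal_point (2 - \<i>)} \<in> farey_edges"
    by (simp_all add: insert_commute)
qed

text \<open>The terms with a factor \<open>y {1, \<i>}\<close> or \<open>y {\<i>, -1}\<close> are moved to the edges \<open>{-1, -\<i>}\<close> and
  \<open>{-\<i>, 1}\<close> by the side pairings; this turns the coefficient of each \<open>y e\<close> into the shear of \<open>x\<close>
  at \<open>e\<close>.\<close>

lemma weil_petersson_log_derivative:
  "weil_petersson m l u v
    = weil_petersson m (\<lambda>_ _. 1) (\<lambda>t e. u t e / l t e) (\<lambda>t e. v t e / l t e)"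
  by (simp add: weil_petersson_def wp_triangle_def dlog_wedge_def)

lemma weil_petersson_shear:
  assumes haar: "haar_probability Ghat Ghat_topology m"
    and xy: "x \<in> invariant_continuous" "y \<in> invariant_continuous"
  shows "weil_petersson m (\<lambda>_ _. 1) x y =
    2 * (LINT t|m. (\<Sum>e\<in>{{1, -1}, {-1, -\<i>}, {-\<i>, 1}}. shear (x t) e * y t e))"
proof -
  interpret compact_haar Ghat Ghat_topology m by (rule compact_haar_ghat[OF haar])
  note cont = invariant_continuous_continuous_map[OF xy(1)] invariant_continuous_continuous_map[OF xy(2)]
  note E = base_edges_farey base_edge_neighbours_farey
  \<comment> \<open>Both triangles at the diagonal lie in the quadrilateral, so its coefficient is
    already a full shear, with a minus sign absorbed by the factor \<open>-2\<close> of the form.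
    The lower sides so far receive only the contribution of the lower triangle.\<close>
  define F0 where "F0 = (\<lambda>t. y t {1, -1} * (- shear (x t) {1, -1})
     + y t {-1, -\<i>} * (x t {1, -1} - x t {-\<i>, 1}) + y t {-\<i>, 1} * (x t {-1, -\<i>} - x t {1, -1}))"
  define Fc where "Fc = (\<lambda>t. y t {1, \<i>} * (x t {1, -1} - x t {\<i>, -1}))"
  define Fd where "Fd = (\<lambda>t. y t {\<i>, -1} * (x t {1, \<i>} - x t {1, -1}))"
  \<comment> \<open>\<open>Fa\<close> and \<open>Fb\<close> are \<open>Fc\<close> and
    \<open>Fd\<close> pulled back by the side pairings; they supply the halves of the shears that
    come from beyond the lower sides.\<close>
  define Fa where "Fa = (\<lambda>t. y t {-1, -\<i>} * (x t {-\<i>, ideal_point (1 - 2 * \<i>)} - x t {-1, ideal_point (1 - 2 * \<i>)}))"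
  define Fb where "Fb = (\<lambda>t. y t {-\<i>, 1} * (x t {1, ideal_point (2 - \<i>)} - x t {-\<i>, ideal_point (2 - \<i>)}))"
  have "continuous_map Ghat_topology euclideanreal F0"
    unfolding F0_def base_edge_shears by (intro continuous_intros cont E)
  moreover have Fc: "continuous_map Ghat_topology euclideanreal Fc"
    unfolding Fc_def by (intro continuous_intros cont E)
  moreover have Fd: "continuous_map Ghat_topology euclideanreal Fd"
    unfolding Fd_def by (intro continuous_intros cont E)
  moreover have "continuous_map Ghat_topology euclideanreal Fa"
    unfolding Fa_def by (intro continuous_intros cont E)
  moreover have "continuous_map Ghat_topology euclideanreal Fb"
    unfolding Fb_def by (intro continuous_intros cont E)
  ultimately have int: "integrable m F0" "integrable m Fc" "integrable m Fd" "integrable m Fa" "integrable m Fb"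
    by (simp_all add: integrable_continuous)
  let ?A = "emb (inv\<^bsub>torus_group\<^esub> torus_gen_a)" and ?B = "emb (inv\<^bsub>torus_group\<^esub> torus_gen_b)"
  \<comment> \<open>Haar measure allows the shift; at the shifted argument invariance replaces the
    image of an edge under the generator by the edge itself.\<close>
  have "(LINT t|m. Fc t) = (LINT t|m. Fc (t \<star> ?A))"
    using Fc torus_generators(1) by (simp add: integral_translation emb_inv_closed)
  also have "\<dots> = (LINT t|m. Fa t)"
  proof (rule Bochner_Integration.integral_cong[OF refl])
    fix t assume "t \<in> space m"
    then have t: "t \<in> carrier Ghat" by (simp add: space_m)
    note I = invariant_continuousD(2)[OF _ t torus_generators(1)]
    show "Fc (t \<star> ?A) = Fa t"
      using I[OF xy(2) E(2)] I[OF xy(1) E(6)] I[OF xy(1) E(7)]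
      unfolding base_edge_images by (simp add: Fc_def Fa_def)
  qed
  finally have ca: "(LINT t|m. Fc t) = (LINT t|m. Fa t)" .
  have "(LINT t|m. Fd t) = (LINT t|m. Fd (t \<star> ?B))"
    using Fd torus_generators(2) by (simp add: integral_translation emb_inv_closed)
  also have "\<dots> = (LINT t|m. Fb t)"
  proof (rule Bochner_Integration.integral_cong[OF refl])
    fix t assume "t \<in> space m"
    then have t: "t \<in> carrier Ghat" by (simp add: space_m)
    note I = invariant_continuousD(2)[OF _ t torus_generators(2)]
    show "Fd (t \<star> ?B) = Fb t"
      using I[OF xy(2) E(3)] I[OF xy(1) E(8)] I[OF xy(1) E(9)]
      unfolding base_edge_images by (simp add: Fd_def Fb_def)
  qed
  finally have db: "(LINT t|m. Fd t) = (LINT t|m. Fb t)" .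
  have "weil_petersson m (\<lambda>_ _. 1) x y = (LINT t|m. -2 * (F0 t + (Fc t + Fd t)))"
    unfolding weil_petersson_def wp_triangle_def dlog_wedge_def F0_def Fc_def Fd_def base_edge_shears
    by (intro Bochner_Integration.integral_cong[OF refl]) (simp add: algebra_simps)
  also have "\<dots> = -2 * ((LINT t|m. F0 t) + ((LINT t|m. Fc t) + (LINT t|m. Fd t)))"
    using int by simp
  also have "\<dots> = (LINT t|m. -2 * (F0 t + (Fa t + Fb t)))"
    using int ca db by simp
  also have "\<dots> = (LINT t|m. 2 * (\<Sum>e\<in>{{1, -1}, {-1, -\<i>}, {-\<i>, 1}}. shear (x t) e * y t e))"
  proof (intro Bochner_Integration.integral_cong[OF refl])
    fix t
    have "(\<Sum>e\<in>{{1, -1}, {-1, -\<i>}, {-\<i>, 1}}. shear (x t) e * y t e)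
      = shear (x t) {1, -1} * y t {1, -1} + shear (x t) {-1, -\<i>} * y t {-1, -\<i>} + shear (x t) {-\<i>, 1} * y t {-\<i>, 1}"
      by (simp add: base_edges_distinct)
    then show "-2 * (F0 t + (Fa t + Fb t)) = 2 * (\<Sum>e\<in>{{1, -1}, {-1, -\<i>}, {-\<i>, 1}}. shear (x t) e * y t e)"
      by (simp add: F0_def Fa_def Fb_def base_edge_shears algebra_simps)
  qed
  finally show ?thesis by simp
qed

section \<open>Descent to Teichmueller space and non-degeneracy\<close>

lemma weil_petersson_skew: "weil_petersson m l v u = - weil_petersson m l u v"
proof -
  have "wp_triangle (l t) (v t) (u t) a b c = - wp_triangle (l t) (u t) (v t) a b c" for t a b c
    by (simp add: wp_triangle_def dlog_wedge_def)
  then have "weil_petersson m l v u = (LINT t|m. - (wp_triangle (l t) (u t) (v t) {1, -1} {-1, -\<i>} {-\<i>, 1} +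
     wp_triangle (l t) (u t) (v t) {1, -1} {1, \<i>} {\<i>, -1}))"
    unfolding weil_petersson_def by (intro Bochner_Integration.integral_cong[OF refl]) simp
  then show ?thesis by (simp only: Bochner_Integration.integral_minus weil_petersson_def)
qed

text \<open>The shear formula sees its first argument only through the shears at the three
  representatives.\<close>

lemma weil_petersson_cong_left:
  assumes haar: "haar_probability Ghat Ghat_topology m"
    and x: "x1 \<in> invariant_continuous" "x2 \<in> invariant_continuous" and y: "y \<in> invariant_continuous"
    and shear: "\<And>t e. t \<in> carrier Ghat \<Longrightarrow> e \<in> farey_edges \<Longrightarrow> shear (x1 t) e = shear (x2 t) e"
  shows "weil_petersson m (\<lambda>_ _. 1) x1 y = weil_petersson m (\<lambda>_ _. 1) x2 y"
proof -
  interpret compact_haar Ghat Ghat_topology m by (rule compact_haar_ghat[OF haar])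
  have "(\<Sum>e\<in>{{1, -1}, {-1, -\<i>}, {-\<i>, 1}}. shear (x1 t) e * y t e)
      = (\<Sum>e\<in>{{1, -1}, {-1, -\<i>}, {-\<i>, 1}}. shear (x2 t) e * y t e)"
    if "t \<in> space m" for t
    using that base_edges_farey by (intro sum.cong refl) (auto simp: space_m shear)
  then show ?thesis
    unfolding weil_petersson_shear[OF haar x(1) y] weil_petersson_shear[OF haar x(2) y]
    by (intro arg_cong[of _ _ "(*) 2"] Bochner_Integration.integral_cong refl)
qed

lemma weil_petersson_projects:
  assumes haar: "haar_probability Ghat Ghat_topology m"
    and l: "l1 \<in> decorated_teichmueller" "l2 \<in> decorated_teichmueller"
    and u: "u1 \<in> invariant_continuous" "u2 \<in> invariant_continuous"
    and v: "v1 \<in> invariant_continuous" "v2 \<in> invariant_continuous"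
    and proj: "teichmueller_proj l1 = teichmueller_proj l2"
      "d_teichmueller_proj l1 u1 = d_teichmueller_proj l2 u2"
      "d_teichmueller_proj l1 v1 = d_teichmueller_proj l2 v2"
  shows "weil_petersson m l1 u1 v1 = weil_petersson m l2 u2 v2"
proof -
  define x1 x2 y1 y2 where "x1 = (\<lambda>t e. u1 t e / l1 t e)" and "x2 = (\<lambda>t e. u2 t e / l2 t e)"
    and "y1 = (\<lambda>t e. v1 t e / l1 t e)" and "y2 = (\<lambda>t e. v2 t e / l2 t e)"
  have IC: "x1 \<in> invariant_continuous" "x2 \<in> invariant_continuous"
    "y1 \<in> invariant_continuous" "y2 \<in> invariant_continuous"
    unfolding x1_def x2_def y1_def y2_def using l u v by (auto intro: invariant_continuous_divide)
  have "shear (x1 t) e = shear (x2 t) e" "shear (y1 t) e = shear (y2 t) e"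
    if "t \<in> carrier Ghat" "e \<in> farey_edges" for t e
    unfolding x1_def x2_def y1_def y2_def
    using that by (auto intro: shear_eq_if_d_teichmueller_proj_eq[OF l proj(1)] proj)
  note eqs = weil_petersson_cong_left[OF haar IC(1,2,3) this(1)]
    weil_petersson_cong_left[OF haar IC(3,4,2) this(2)]
  have "weil_petersson m l1 u1 v1 = weil_petersson m (\<lambda>_ _. 1) x1 y1"
    unfolding x1_def y1_def by (rule weil_petersson_log_derivative)
  also have "\<dots> = weil_petersson m (\<lambda>_ _. 1) x2 y1" by (rule eqs)
  \<comment> \<open>Skew symmetry brings the remaining argument to the first place, where the
    congruence applies.\<close>
  also have "\<dots> = - weil_petersson m (\<lambda>_ _. 1) y1 x2" by (rule weil_petersson_skew)
  also have "\<dots> = - weil_petersson m (\<lambda>_ _. 1) y2 x2" by (simp only: eqs)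
  also have "\<dots> = weil_petersson m (\<lambda>_ _. 1) x2 y2" using weil_petersson_skew by metis
  also have "\<dots> = weil_petersson m l2 u2 v2"
    unfolding x2_def y2_def by (rule weil_petersson_log_derivative[symmetric])
  finally show ?thesis .
qed

lemma weil_petersson_nondegenerate:
  assumes haar: "haar_probability Ghat Ghat_topology m"
    and l: "l \<in> decorated_teichmueller" and v: "v \<in> invariant_continuous"
    and zero: "\<And>u. u \<in> invariant_continuous \<Longrightarrow> weil_petersson m l u v = 0"
  shows "d_teichmueller_proj l v = (\<lambda>_. 0)"
proof (rule d_teichmueller_proj_eq_0[OF l])
  interpret compact_haar Ghat Ghat_topology m by (rule compact_haar_ghat[OF haar])
  define y where "y = (\<lambda>t e. v t e / l t e)"
  define S where "S = (\<lambda>t. shear (y t))"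
  \<comment> \<open>\<open>S\<close> serves as the tangent vector at \<open>l\<close>, and
    \<open>x\<close> is its logarithmic derivative; each summand \<open>S t e * x t e\<close> below
    is a square divided by a lambda length.\<close>
  define x where "x = (\<lambda>t e. S t e / l t e)"
  have y: "y \<in> invariant_continuous" unfolding y_def using v l by (rule invariant_continuous_divide)
  then have S: "S \<in> invariant_continuous" unfolding S_def by (rule invariant_continuous_shear)
  then have x: "x \<in> invariant_continuous" unfolding x_def using l by (rule invariant_continuous_divide)
  have pos: "l t e > 0" if "t \<in> carrier Ghat" "e \<in> farey_edges" for t e
    using l that by (simp add: decorated_teichmueller_def)
  define F where "F = (\<lambda>t. \<Sum>e\<in>{{1, -1}, {-1, -\<i>}, {-\<i>, 1}}. S t e * x t e)"
  have F_nonneg: "0 \<le> S t e * x t e" if "t \<in> carrier Ghat" "e \<in> farey_edges" for t e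
    using pos[OF that] by (simp add: x_def)
  have "0 = weil_petersson m l S v" using zero[OF S] by simp
  also have "\<dots> = weil_petersson m (\<lambda>_ _. 1) x y"
    unfolding x_def y_def by (rule weil_petersson_log_derivative)
  also have "\<dots> = - weil_petersson m (\<lambda>_ _. 1) y x" by (rule weil_petersson_skew)
  also have "\<dots> = - (2 * (LINT t|m. F t))"
    unfolding F_def S_def weil_petersson_shear[OF haar y x] ..
  finally have "(LINT t|m. F t) = 0" by simp
  moreover have "continuous_map Ghat_topology euclideanreal F"
    unfolding F_def using base_edges_farey
    by (intro continuous_map_sum continuous_map_real_mult invariant_continuous_continuous_map[OF S]
        invariant_continuous_continuous_map[OF x]) auto
  moreover have "0 \<le> F t" if "t \<in> carrier Ghat" for t
    unfolding F_def using base_edges_farey that by (intro sum_nonneg F_nonneg) auto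
  ultimately have F0: "F t = 0" if "t \<in> carrier Ghat" for t
    using that integral_nonneg_eq_0 by blast
  have S0: "S t e = 0" if t: "t \<in> carrier Ghat" and e: "e \<in> {{1, -1}, {-1, -\<i>}, {-\<i>, 1}}" for t e
  proof -
    have "S t e * x t e = 0"
      using F0[OF t] base_edges_farey e t F_nonneg unfolding F_def
      by (subst (asm) sum_nonneg_eq_0_iff) auto
    moreover have "l t e > 0" using pos[OF t] e base_edges_farey by auto
    ultimately show ?thesis by (simp add: x_def)
  qed
  fix t e assume t: "t \<in> carrier Ghat" and "e \<in> farey_edges"
  \<comment> \<open>\<open>S\<close> vanishes at the representatives for every \<open>t\<close>, so
    a shift of \<open>t\<close> gives its vanishing at every edge.\<close>
  from this(2) obtain g e0 where g: "g \<in> carrier torus_group" "e0 \<in> {{1, -1}, {-1, -\<i>}, {-\<i>, 1}}" "e = g ` e0"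
    by (rule farey_edge_orbit)
  then have "e0 \<in> farey_edges" using base_edges_farey by auto
  with g t have "S t e = S (t \<star> emb g) e0" by (simp add: invariant_continuous_orbit[OF S])
  also have "\<dots> = 0" using S0[OF ghat_mult_closed[OF t emb_closed[OF g(1)]] g(2)] .
  finally show "shear (\<lambda>e. v t e / l t e) e = 0" by (simp add: S_def y_def)
qed

theorem theorem9p2:
  fixes m :: "ghat measure"
  assumes "haar_probability Ghat Ghat_topology m"
  shows "(\<forall>l1\<in>decorated_teichmueller. \<forall>l2\<in>decorated_teichmueller.
            \<forall>u1\<in>invariant_continuous. \<forall>v1\<in>invariant_continuous.
            \<forall>u2\<in>invariant_continuous. \<forall>v2\<in>invariant_continuous.
              teichmueller_proj l1 = teichmueller_proj l2 \<and>
              d_teichmueller_proj l1 u1 = d_teichmueller_proj l2 u2 \<and>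
              d_teichmueller_proj l1 v1 = d_teichmueller_proj l2 v2 \<longrightarrow>
              weil_petersson m l1 u1 v1 = weil_petersson m l2 u2 v2) \<and>
         (\<forall>l\<in>decorated_teichmueller. \<forall>v\<in>invariant_continuous.
            d_teichmueller_proj l v \<noteq> (\<lambda>_. 0) \<longrightarrow>
            (\<exists>u\<in>invariant_continuous. weil_petersson m l u v \<noteq> 0))"
  using weil_petersson_projects[OF assms] weil_petersson_nondegenerate[OF assms] by blast

end
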